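(* Let $I\subseteq\mathbb{R}$ be an open interval and let $P(t)(x)=x^n+\sum_{j=1}^n(-1)^j a_j(t)x^{n-j}$, $t\in I$, be a curve of monic complex polynomials with definable continuous coefficients $a_j:I\to\mathbb{C}$. Then any continuous choice of the roots of $P$ is locally absolutely continuous: if $\lambda_1,\dots,\lambda_n:I\to\mathbb{C}$ are continuous functions with $P(t)(x)=\prod_{j=1}^n(x-\lambda_j(t))$ for all $t\in I$, then each $\lambda_j$ is absolutely continuous on every compact subinterval of $I$.
   Context: Fix an arbitrary o-minimal structure $\mathcal{M}$ on $(\mathbb{R},+,\cdot)$: families $\mathcal{M}_n$ of subsets of $\mathbb{R}^n$ ($n\ge 1$) closed under finite set-theoretical operations, products and coordinate projections, containing all sets $\{f=0, g_1>0,\dots,g_l>0\}$ with $f,g_i$ real polynomials, and such that $\mathcal{M}_1$ consists exactly of the finite unions of open intervals and points. A set is definable if it belongs to some $\mathcal{M}_n$; a map between subsets of Euclidean spaces is definable if its graph is definable. A complex valued function $f$ on an interval is definable if $(\operatorname{Re} f,\operatorname{Im} f)$ is definable as a map into $\mathbb{R}^2$. *)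

theory Defs
  imports "HOL-Analysis.Analysis" "HOL-Computational_Algebra.Polynomial"
begin

(* Points of R^n are real lists of length n, because o-minimal structures relate
   all dimensions n at once. *)
definition Rn :: "nat \<Rightarrow> real list set" where
  "Rn n = {x. length x = n}"

definition polynomial_fun :: "nat \<Rightarrow> (real list \<Rightarrow> real) \<Rightarrow> bool" where
  "polynomial_fun n f \<longleftrightarrow>
    (\<exists>(E :: (nat \<Rightarrow> nat) set) c. finite E \<and>
      (\<forall>x\<in>Rn n. f x = (\<Sum>\<alpha>\<in>E. c \<alpha> * (\<Prod>i<n. (x ! i) ^ \<alpha> i))))"

(* O-minimal structures expanding the real field. Only the families M n with n \<ge> 1 matter; M 0 is
   unconstrained and never used. The map x \<mapsto> nths x J is the coordinate projection of
   R^n onto the coordinates in J. Open intervals may be unbounded (or empty). *)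
locale o_minimal_structure =
  fixes M :: "nat \<Rightarrow> real list set set"
  assumes subset_Rn: "n \<ge> 1 \<Longrightarrow> A \<in> M n \<Longrightarrow> A \<subseteq> Rn n"
    and Un_closed: "n \<ge> 1 \<Longrightarrow> A \<in> M n \<Longrightarrow> B \<in> M n \<Longrightarrow> A \<union> B \<in> M n"
    and Int_closed: "n \<ge> 1 \<Longrightarrow> A \<in> M n \<Longrightarrow> B \<in> M n \<Longrightarrow> A \<inter> B \<in> M n"
    and Diff_closed: "n \<ge> 1 \<Longrightarrow> A \<in> M n \<Longrightarrow> B \<in> M n \<Longrightarrow> A - B \<in> M n"
    and product_closed:
      "m \<ge> 1 \<Longrightarrow> n \<ge> 1 \<Longrightarrow> A \<in> M m \<Longrightarrow> B \<in> M n \<Longrightarrow> {x @ y |x y. x \<in> A \<and> y \<in> B} \<in> M (m + n)"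
    and projection_closed:
      "n \<ge> 1 \<Longrightarrow> A \<in> M n \<Longrightarrow> J \<subseteq> {..<n} \<Longrightarrow> J \<noteq> {} \<Longrightarrow> (\<lambda>x. nths x J) ` A \<in> M (card J)"
    and basic_semialgebraic:
      "n \<ge> 1 \<Longrightarrow> polynomial_fun n f \<Longrightarrow> finite G \<Longrightarrow> (\<And>g. g \<in> G \<Longrightarrow> polynomial_fun n g) \<Longrightarrow>
        {x \<in> Rn n. f x = 0 \<and> (\<forall>g\<in>G. g x > 0)} \<in> M n"
    and o_minimality:
      "A \<in> M 1 \<longleftrightarrow>
        (\<exists>F. finite F \<and> (\<forall>S\<in>F. is_interval S \<and> open S \<or> (\<exists>p. S = {p})) \<and> A = (\<lambda>t. [t]) ` \<Union>F)"

definition definable_map ::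
    "(nat \<Rightarrow> real list set set) \<Rightarrow> nat \<Rightarrow> nat \<Rightarrow> real list set \<Rightarrow> (real list \<Rightarrow> real list) \<Rightarrow> bool" where
  "definable_map M m k A f \<longleftrightarrow>
    A \<subseteq> Rn m \<and> f ` A \<subseteq> Rn k \<and> (\<lambda>x. x @ f x) ` A \<in> M (m + k)"

definition definable_complex_fun ::
    "(nat \<Rightarrow> real list set set) \<Rightarrow> real set \<Rightarrow> (real \<Rightarrow> complex) \<Rightarrow> bool" where
  "definable_complex_fun M I f \<longleftrightarrow>
    definable_map M 1 2 ((\<lambda>t. [t]) ` I) (\<lambda>x. [Re (f (hd x)), Im (f (hd x))])"

(* Each (u, v) in D stands for the interval [u, v]; distinct intervals of D do not overlap. *)
definition absolutely_continuous_on :: "real set \<Rightarrow> (real \<Rightarrow> complex) \<Rightarrow> bool" where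
  "absolutely_continuous_on S f \<longleftrightarrow>
    (\<forall>\<epsilon>>0. \<exists>\<delta>>0. \<forall>D. finite D \<longrightarrow>
      (\<forall>(u, v)\<in>D. u \<le> v \<and> {u..v} \<subseteq> S) \<longrightarrow>
      pairwise (\<lambda>(u, v) (u', v'). {u<..<v} \<inter> {u'<..<v'} = {}) D \<longrightarrow>
      (\<Sum>(u, v)\<in>D. v - u) < \<delta> \<longrightarrow>
      (\<Sum>(u, v)\<in>D. norm (f v - f u)) < \<epsilon>)"

end

theory Submission
  imports Defs
begin

text \<open>
  Continuity of the roots is given; what has to be excluded is a devil's staircase, and it is
  definability that excludes it. The real parts of the roots of \<open>P t\<close> are the numbers \<open>x\<close>
  such that \<open>x + i y\<close> is a root for some \<open>y\<close>, so they form the fibre over \<open>t\<close> of a set definable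
  from the coefficients, and likewise for the imaginary parts. Hence it suffices to treat one
  definable subset \<open>S\<close> of the plane whose fibre over \<open>t\<close> is \<open>{f\<^sub>1 t, \<dots>, f\<^sub>n t}\<close> with
  continuous \<open>f\<^sub>j\<close> (\<open>absolutely_continuous_on_branch\<close>).

  Splitting real and imaginary parts makes the fibres subsets of an ordered field, and the branches
  can be recognised by their position. The set of \<open>t\<close> whose fibre has at least \<open>m\<close> points is
  definable, so away from finitely many \<open>t\<close> the fibres have locally constant size. While the size
  does not change, the number of points of the fibre below \<open>f\<^sub>j t\<close> and the number of points above it
  are both lower semicontinuous in \<open>t\<close> and have a constant sum; so both are locally constant. On
  each of finitely many intervals \<open>f\<^sub>j\<close> is therefore the \<open>l\<close>-th smallest point of the fibre for a
  fixed \<open>l\<close>, and this is a definable function.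

  For a continuous definable function \<open>h\<close> on an interval, o-minimality is used in the form
  that a definable subset of the line has a finite frontier (\<open>finite_frontier_definable\<close>).
  Immediately to the right of each \<open>t\<close> either \<open>h \<ge> h t\<close> or \<open>h < h t\<close>, and which of the two happens can
  change only finitely often, so \<open>h\<close> is piecewise monotone (\<open>definable_piecewise_monotone\<close>).
  The set where \<open>h\<close> is locally Lipschitz is definable, and it is dense: if \<open>h\<close> is increasing and
  \<open>K\<close> exceeds some difference quotient of \<open>h\<close>, then \<open>h t - K t\<close> is not increasing, so it is decreasing
  on some subinterval, where \<open>K\<close> is then a Lipschitz constant of \<open>h\<close>. A dense set with finite
  frontier misses only finitely many points, so \<open>h\<close> is locally Lipschitz away from finitely many points
  (\<open>definable_piecewise_locally_lipschitz\<close>).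

  Finally, a continuous function on \<open>[p, q]\<close> that is monotone and locally Lipschitz on \<open>(p, q)\<close> is
  absolutely continuous: it is Lipschitz on each compact subinterval of \<open>(p, q)\<close>, and on the two short
  remaining pieces monotonicity bounds the sum of all increments by the total increment, which is small
  by continuity. Gluing finitely many such pieces gives the result.
\<close>

section \<open>First-order definability in an o-minimal structure\<close>

lemma polynomial_fun_add:
  assumes "polynomial_fun n f" "polynomial_fun n g"
  shows "polynomial_fun n (\<lambda>x. f x + g x)"
proof -
  define m where "m x \<alpha> = (\<Prod>i<n. (x ! i) ^ \<alpha> i)" for x :: "real list" and \<alpha>
  from assms obtain E c E' c' where E: "finite E" "finite E'"
    and f: "\<forall>x\<in>Rn n. f x = (\<Sum>\<alpha>\<in>E. c \<alpha> * m x \<alpha>)"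
    and g: "\<forall>x\<in>Rn n. g x = (\<Sum>\<alpha>\<in>E'. c' \<alpha> * m x \<alpha>)"
    unfolding polynomial_fun_def m_def by blast
  have "f x + g x = (\<Sum>\<alpha>\<in>E \<union> E'. ((if \<alpha> \<in> E then c \<alpha> else 0) + (if \<alpha> \<in> E' then c' \<alpha> else 0)) * m x \<alpha>)"
    if "x \<in> Rn n" for x
  proof -
    have "(\<Sum>\<alpha>\<in>E \<union> E'. (if \<alpha> \<in> E then c \<alpha> else 0) * m x \<alpha>) = f x"
      using E f that by (auto intro!: sum.mono_neutral_cong_right)
    moreover have "(\<Sum>\<alpha>\<in>E \<union> E'. (if \<alpha> \<in> E' then c' \<alpha> else 0) * m x \<alpha>) = g x"
      using E g that by (auto intro!: sum.mono_neutral_cong_right)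
    ultimately show ?thesis
      by (simp add: distrib_right sum.distrib)
  qed
  then show ?thesis
    unfolding polynomial_fun_def m_def[symmetric] using E
    by (intro exI[of _ "E \<union> E'"]
        exI[of _ "\<lambda>\<alpha>. (if \<alpha> \<in> E then c \<alpha> else 0) + (if \<alpha> \<in> E' then c' \<alpha> else 0)"]) blast
qed

lemma polynomial_fun_monomial:
  "polynomial_fun n (\<lambda>x. c * (\<Prod>i<n. (x ! i) ^ \<alpha> i))"
  unfolding polynomial_fun_def by (intro exI[of _ "{\<alpha>}"] exI[of _ "\<lambda>_. c"]) simp

lemma polynomial_fun_const: "polynomial_fun n (\<lambda>x. c)"
  using polynomial_fun_monomial[of n c "\<lambda>_. 0"] by simp

lemma polynomial_fun_var:
  assumes "i < n" shows "polynomial_fun n (\<lambda>x. c * x ! i)"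
proof -
  have "(\<Prod>k<n. (x ! k) ^ (if k = i then 1 else 0)) = x ! i" for x :: "real list"
  proof -
    have "(\<Prod>k<n. (x ! k) ^ (if k = i then 1 else 0)) = (\<Prod>k<n. if k = i then x ! k else 1)"
      by (intro prod.cong) auto
    then show ?thesis using assms by simp
  qed
  then show ?thesis
    using polynomial_fun_monomial[of n c "\<lambda>k. if k = i then 1 else 0"] by simp
qed

text \<open>
  Affine polynomials and products of two variables suffice below: other terms are built by
  substitution from the graphs of addition and multiplication.
\<close>

lemma polynomial_fun_var_mult:
  assumes "i < n" "j < n" shows "polynomial_fun n (\<lambda>x. c * (x ! i * x ! j))"
proof -
  have "(\<Prod>k<n. (x ! k) ^ ((if k = i then 1 else 0) + (if k = j then 1 else 0))) = x ! i * x ! j"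
    for x :: "real list"
  proof -
    have "(\<Prod>k<n. (x ! k) ^ ((if k = i then 1 else 0) + (if k = j then 1 else 0)))
        = (\<Prod>k<n. (if k = i then x ! k else 1) * (if k = j then x ! k else 1))"
      by (intro prod.cong) auto
    then show ?thesis using assms by (simp add: prod.distrib)
  qed
  then show ?thesis
    using polynomial_fun_monomial[of n c "\<lambda>k. (if k = i then 1 else 0) + (if k = j then 1 else 0)"]
    by simp
qed

context o_minimal_structure
begin

text \<open>
  Predicates on lists serve as formulas in the variables \<open>x ! 0, \<dots>, x ! (n - 1)\<close>. The closure
  properties below show that every first-order formula over definable data is again definable; a
  quantifier binds the new last variable \<open>x ! n\<close>.
\<close>

definition definable :: "nat \<Rightarrow> (real list \<Rightarrow> bool) \<Rightarrow> bool" where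
  "definable n \<phi> \<longleftrightarrow> 0 < n \<and> {x \<in> Rn n. \<phi> x} \<in> M n"

text \<open>
  Definability of the graph: the last coordinate \<open>x ! n\<close> is the value at the first \<open>n\<close> ones.
\<close>

definition definable_fun :: "nat \<Rightarrow> (real list \<Rightarrow> real) \<Rightarrow> bool" where
  "definable_fun n f \<longleftrightarrow> 0 < n \<and> definable (Suc n) (\<lambda>x. x ! n = f (take n x))"

lemma definable_cong:
  assumes "definable n \<phi>" "\<And>x. length x = n \<Longrightarrow> \<phi> x = \<psi> x"
  shows "definable n \<psi>"
proof -
  have "{x \<in> Rn n. \<phi> x} = {x \<in> Rn n. \<psi> x}" using assms(2) by (auto simp: Rn_def)
  then show ?thesis using assms(1) by (simp add: definable_def)
qed

lemma definable_eq_0: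
  assumes "0 < n" "polynomial_fun n f"
  shows "definable n (\<lambda>x. f x = 0)"
  using basic_semialgebraic[of n f "{}"] assms by (simp add: definable_def)

lemma definable_gt_0:
  assumes "0 < n" "polynomial_fun n f"
  shows "definable n (\<lambda>x. f x > 0)"
  using basic_semialgebraic[of n "\<lambda>_. 0" "{f}"] assms polynomial_fun_const[of n 0]
  by (simp add: definable_def)

lemma definable_True: "0 < n \<Longrightarrow> definable n (\<lambda>x. True)"
  using definable_eq_0[OF _ polynomial_fun_const[of n 0]] by simp

lemma definable_conj:
  assumes "definable n \<phi>" "definable n \<psi>"
  shows "definable n (\<lambda>x. \<phi> x \<and> \<psi> x)"
proof -
  have "{x \<in> Rn n. \<phi> x \<and> \<psi> x} = {x \<in> Rn n. \<phi> x} \<inter> {x \<in> Rn n. \<psi> x}" by auto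
  then show ?thesis using assms Int_closed by (simp add: definable_def)
qed

lemma definable_not:
  assumes "definable n \<phi>"
  shows "definable n (\<lambda>x. \<not> \<phi> x)"
proof -
  have "{x \<in> Rn n. \<not> \<phi> x} = {x \<in> Rn n. True} - {x \<in> Rn n. \<phi> x}" by auto
  then show ?thesis using assms Diff_closed definable_True[of n] by (simp add: definable_def)
qed

lemma definable_disj:
  assumes "definable n \<phi>" "definable n \<psi>"
  shows "definable n (\<lambda>x. \<phi> x \<or> \<psi> x)"
  using definable_not[OF definable_conj[OF definable_not[OF assms(1)] definable_not[OF assms(2)]]]
  by simp

lemma definable_imp:
  assumes "definable n \<phi>" "definable n \<psi>"
  shows "definable n (\<lambda>x. \<phi> x \<longrightarrow> \<psi> x)"
  using definable_disj[OF definable_not[OF assms(1)] assms(2)] by simp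

lemma definable_bounded_all:
  fixes k :: nat
  assumes "0 < n" "\<And>i. i < k \<Longrightarrow> definable n (\<phi> i)"
  shows "definable n (\<lambda>x. \<forall>i<k. \<phi> i x)"
  using assms(2)
proof (induction k)
  case 0
  then show ?case using definable_True[OF assms(1)] by simp
next
  case (Suc k)
  then have "definable n (\<lambda>x. (\<forall>i<k. \<phi> i x) \<and> \<phi> k x)"
    by (intro definable_conj) auto
  then show ?case by (rule definable_cong) (auto simp: less_Suc_eq)
qed

text \<open>
  Existential quantification is projection to the first \<open>n\<close> coordinates.
\<close>

lemma definable_ex_list:
  assumes "0 < n" "definable (n + k) \<phi>"
  shows "definable n (\<lambda>x. \<exists>z\<in>Rn k. \<phi> (x @ z))"
proof -
  have "(\<lambda>x. nths x {..<n}) ` {w \<in> Rn (n + k). \<phi> w} \<in> M (card {..<n})"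
    using assms by (intro projection_closed) (auto simp: definable_def)
  moreover have "(\<lambda>x. nths x {..<n}) ` {w \<in> Rn (n + k). \<phi> w} = {x \<in> Rn n. \<exists>z\<in>Rn k. \<phi> (x @ z)}"
  proof (intro equalityI subsetI)
    fix x assume "x \<in> (\<lambda>x. nths x {..<n}) ` {w \<in> Rn (n + k). \<phi> w}"
    then obtain w where "x = take n w" "length w = n + k" "\<phi> w"
      by (auto simp: Rn_def)
    then show "x \<in> {x \<in> Rn n. \<exists>z\<in>Rn k. \<phi> (x @ z)}"
      by (auto simp: Rn_def intro!: exI[of _ "drop n w"])
  next
    fix x assume "x \<in> {x \<in> Rn n. \<exists>z\<in>Rn k. \<phi> (x @ z)}"
    then obtain z where "length x = n" "length z = k" "\<phi> (x @ z)" by (auto simp: Rn_def)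
    then show "x \<in> (\<lambda>x. nths x {..<n}) ` {w \<in> Rn (n + k). \<phi> w}"
      by (intro image_eqI[of _ _ "x @ z"]) (auto simp: Rn_def)
  qed
  ultimately show ?thesis using assms(1) by (simp add: definable_def)
qed

lemma definable_ex:
  assumes "0 < n" "definable (Suc n) (\<lambda>x. \<phi> (take n x) (x ! n))"
  shows "definable n (\<lambda>x. \<exists>y. \<phi> x y)"
proof -
  have "definable n (\<lambda>x. \<exists>z\<in>Rn 1. \<phi> (take n (x @ z)) ((x @ z) ! n))"
    using assms by (intro definable_ex_list) auto
  then show ?thesis
    by (rule definable_cong) (force simp: Rn_def length_Suc_conv nth_append)
qed

lemma definable_all:
  assumes "0 < n" "definable (Suc n) (\<lambda>x. \<phi> (take n x) (x ! n))"
  shows "definable n (\<lambda>x. \<forall>y. \<phi> x y)"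
  using definable_not[OF definable_ex[OF assms(1) definable_not[OF assms(2)]]] by simp

text \<open>
  Substituting functions for the variables of \<open>\<phi>\<close> means quantifying over their values:
  \<open>\<phi> (g\<^sub>0 x, g\<^sub>1 x, \<dots>)\<close> holds iff some \<open>z\<close> satisfies \<open>\<phi> z\<close> and \<open>z ! i = g\<^sub>i x\<close> for all \<open>i\<close>. The hypothesis
  asks for the graphs in the space of all \<open>n + k\<close> variables, because transporting a graph into that
  space is itself a substitution, namely of coordinates, whose graphs are given by polynomials.
\<close>

lemma definable_subst_graphs:
  assumes "0 < n" "definable k \<phi>"
    and g: "\<And>i. i < k \<Longrightarrow> definable (n + k) (\<lambda>w. w ! (n + i) = g i (take n w))"
  shows "definable n (\<lambda>x. \<phi> (map (\<lambda>i. g i x) [0..<k]))"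
proof -
  have "{x @ y |x y. x \<in> {x \<in> Rn n. True} \<and> y \<in> {y \<in> Rn k. \<phi> y}} \<in> M (n + k)"
    using assms(1,2) definable_True[of n] by (intro product_closed) (auto simp: definable_def)
  also have "{x @ y |x y. x \<in> {x \<in> Rn n. True} \<and> y \<in> {y \<in> Rn k. \<phi> y}} = {w \<in> Rn (n + k). \<phi> (drop n w)}"
  proof (intro equalityI subsetI)
    fix w assume "w \<in> {w \<in> Rn (n + k). \<phi> (drop n w)}"
    then have "w = take n w @ drop n w" "length (take n w) = n" "length (drop n w) = k" "\<phi> (drop n w)"
      by (auto simp: Rn_def)
    then show "w \<in> {x @ y |x y. x \<in> {x \<in> Rn n. True} \<and> y \<in> {y \<in> Rn k. \<phi> y}}"
      unfolding Rn_def by blast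
  qed (auto simp: Rn_def)
  finally have "definable (n + k) (\<lambda>w. \<phi> (drop n w))"
    using assms(1) by (simp add: definable_def)
  moreover have "definable (n + k) (\<lambda>w. \<forall>i<k. w ! (n + i) = g i (take n w))"
    using assms by (intro definable_bounded_all) auto
  ultimately have "definable n (\<lambda>x. \<exists>z\<in>Rn k. \<phi> (drop n (x @ z)) \<and>
      (\<forall>i<k. (x @ z) ! (n + i) = g i (take n (x @ z))))"
    using assms(1) by (intro definable_ex_list definable_conj)
  then show ?thesis
  proof (rule definable_cong)
    fix x :: "real list" assume x: "length x = n"
    have "(\<forall>i<k. (x @ z) ! (n + i) = g i (take n (x @ z))) \<longleftrightarrow> z = map (\<lambda>i. g i x) [0..<k]"
      if "z \<in> Rn k" for z
      using that x by (auto simp: Rn_def list_eq_iff_nth_eq nth_append)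
    then show "(\<exists>z\<in>Rn k. \<phi> (drop n (x @ z)) \<and> (\<forall>i<k. (x @ z) ! (n + i) = g i (take n (x @ z))))
        \<longleftrightarrow> \<phi> (map (\<lambda>i. g i x) [0..<k])"
      using x by (auto simp: Rn_def)
  qed
qed

lemma definable_rename:
  assumes "0 < n" "definable k \<phi>" "\<And>i. i < k \<Longrightarrow> \<sigma> i < n"
  shows "definable n (\<lambda>x. \<phi> (map (\<lambda>i. x ! \<sigma> i) [0..<k]))"
proof (rule definable_subst_graphs[OF assms(1,2)])
  fix i assume i: "i < k"
  have "definable (n + k) (\<lambda>w. 1 * w ! (n + i) + (-1) * w ! \<sigma> i = 0)"
    using assms(1) i assms(3)[OF i]
    by (intro definable_eq_0 polynomial_fun_add polynomial_fun_var) auto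
  then show "definable (n + k) (\<lambda>w. w ! (n + i) = take n w ! \<sigma> i)"
    by (rule definable_cong) (use assms(3)[OF i] in auto)
qed

lemma definable_subst:
  assumes "0 < n" "definable k \<phi>" "\<And>i. i < k \<Longrightarrow> definable_fun n (g i)"
  shows "definable n (\<lambda>x. \<phi> (map (\<lambda>i. g i x) [0..<k]))"
proof (rule definable_subst_graphs[OF assms(1,2)])
  fix i assume i: "i < k"
  \<comment> \<open>read the graph of \<open>g i\<close> at the coordinates 0, ..., n - 1 and n + i\<close>
  let ?\<sigma> = "\<lambda>j. if j < n then j else n + i"
  have "definable (n + k) (\<lambda>x. (map (\<lambda>j. x ! ?\<sigma> j) [0..<Suc n]) ! n
      = g i (take n (map (\<lambda>j. x ! ?\<sigma> j) [0..<Suc n])))"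
    by (rule definable_rename) (use i assms in \<open>auto simp: definable_fun_def\<close>)
  then show "definable (n + k) (\<lambda>w. w ! (n + i) = g i (take n w))"
  proof (rule definable_cong)
    fix x :: "real list" assume "length x = n + k"
    then have "take n (map (\<lambda>j. x ! ?\<sigma> j) [0..<Suc n]) = take n x"
      by (auto simp: list_eq_iff_nth_eq simp del: upt_Suc)
    then show "((map (\<lambda>j. x ! ?\<sigma> j) [0..<Suc n]) ! n
      = g i (take n (map (\<lambda>j. x ! ?\<sigma> j) [0..<Suc n]))) = (x ! (n + i) = g i (take n x))"
      by (simp del: upt_Suc)
  qed
qed

lemma definable_subst1:
  assumes "definable 1 (\<lambda>x. R (x ! 0))" "definable_fun n g"
  shows "definable n (\<lambda>x. R (g x))"
proof -
  have "0 < n" using assms by (simp add: definable_fun_def)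
  from definable_subst[OF this assms(1), of "\<lambda>_. g"] assms(2) show ?thesis by simp
qed

lemma definable_subst2:
  assumes "definable 2 (\<lambda>x. R (x ! 0) (x ! 1))" "definable_fun n g" "definable_fun n h"
  shows "definable n (\<lambda>x. R (g x) (h x))"
proof -
  have "0 < n" using assms by (simp add: definable_fun_def)
  from definable_subst[OF this assms(1), of "\<lambda>i. if i = 0 then g else h"] assms(2,3)
  show ?thesis by (simp add: upt_conv_Cons less_Suc_eq)
qed

lemma definable_subst3:
  assumes "definable 3 (\<lambda>x. R (x ! 0) (x ! 1) (x ! 2))"
    "definable_fun n f" "definable_fun n g" "definable_fun n h"
  shows "definable n (\<lambda>x. R (f x) (g x) (h x))"
proof -
  have "0 < n" using assms by (simp add: definable_fun_def)
  from definable_subst[OF this assms(1), of "\<lambda>i. if i = 0 then f else if i = 1 then g else h"] assms(2-4)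
  show ?thesis by (simp add: upt_conv_Cons)
qed

lemma definable_fun_var:
  assumes "i < n" shows "definable_fun n (\<lambda>x. x ! i)"
proof -
  have "definable (Suc n) (\<lambda>w. 1 * w ! n + (-1) * w ! i = 0)"
    using assms by (intro definable_eq_0 polynomial_fun_add polynomial_fun_var) auto
  then have "definable (Suc n) (\<lambda>w. w ! n = take n w ! i)"
    by (rule definable_cong) (use assms in auto)
  then show ?thesis using assms by (simp add: definable_fun_def)
qed

lemma definable_fun_const:
  assumes "0 < n" shows "definable_fun n (\<lambda>x. c)"
proof -
  have "definable (Suc n) (\<lambda>w. 1 * w ! n + (-c) = 0)"
    using assms by (intro definable_eq_0 polynomial_fun_add polynomial_fun_var polynomial_fun_const) auto
  then show ?thesis using assms by (simp add: definable_fun_def)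
qed

lemma definable_fun_take:
  assumes "definable_fun n f" shows "definable_fun (Suc n) (\<lambda>x. f (take n x))"
proof -
  let ?\<sigma> = "\<lambda>j. if j < n then j else Suc n"
  have "definable (Suc (Suc n)) (\<lambda>x. (map (\<lambda>j. x ! ?\<sigma> j) [0..<Suc n]) ! n
      = f (take n (map (\<lambda>j. x ! ?\<sigma> j) [0..<Suc n])))"
    by (rule definable_rename) (use assms in \<open>auto simp: definable_fun_def\<close>)
  then have "definable (Suc (Suc n)) (\<lambda>x. x ! Suc n = f (take n (take (Suc n) x)))"
  proof (rule definable_cong)
    fix x :: "real list" assume "length x = Suc (Suc n)"
    then have "take n (map (\<lambda>j. x ! ?\<sigma> j) [0..<Suc n]) = take n x"
      by (auto simp: list_eq_iff_nth_eq simp del: upt_Suc)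
    then show "((map (\<lambda>j. x ! ?\<sigma> j) [0..<Suc n]) ! n
      = f (take n (map (\<lambda>j. x ! ?\<sigma> j) [0..<Suc n]))) = (x ! Suc n = f (take n (take (Suc n) x)))"
      by (simp del: upt_Suc)
  qed
  then show ?thesis by (simp add: definable_fun_def)
qed

lemma definable_fun_subst1:
  assumes "definable 2 (\<lambda>x. x ! 1 = F (x ! 0))" "definable_fun n f"
  shows "definable_fun n (\<lambda>x. F (f x))"
  unfolding definable_fun_def
  using definable_subst2[OF assms(1) definable_fun_take[OF assms(2)] definable_fun_var[of n "Suc n"]]
    assms(2) by (simp add: definable_fun_def)

lemma definable_fun_subst2:
  assumes "definable 3 (\<lambda>x. x ! 2 = F (x ! 0) (x ! 1))" "definable_fun n f" "definable_fun n g"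
  shows "definable_fun n (\<lambda>x. F (f x) (g x))"
  unfolding definable_fun_def
  using definable_subst3[OF assms(1) definable_fun_take[OF assms(2)] definable_fun_take[OF assms(3)]
      definable_fun_var[of n "Suc n"]]
    assms(2) by (simp add: definable_fun_def)

lemma definable_fun_add:
  assumes "definable_fun n f" "definable_fun n g"
  shows "definable_fun n (\<lambda>x. f x + g x)"
proof (rule definable_fun_subst2[OF _ assms])
  have "definable 3 (\<lambda>x. ((1 * x ! 0) + (1 * x ! 1)) + (-1) * x ! 2 = 0)"
    by (intro definable_eq_0 polynomial_fun_add polynomial_fun_var) auto
  then show "definable 3 (\<lambda>x. x ! 2 = x ! 0 + x ! 1)"
    by (rule definable_cong) auto
qed

lemma definable_fun_mult:
  assumes "definable_fun n f" "definable_fun n g"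
  shows "definable_fun n (\<lambda>x. f x * g x)"
proof (rule definable_fun_subst2[OF _ assms])
  have "definable 3 (\<lambda>x. 1 * (x ! 0 * x ! 1) + (-1) * x ! 2 = 0)"
    by (intro definable_eq_0 polynomial_fun_add polynomial_fun_var polynomial_fun_var_mult) auto
  then show "definable 3 (\<lambda>x. x ! 2 = x ! 0 * x ! 1)"
    by (rule definable_cong) auto
qed

lemma definable_fun_minus:
  assumes "definable_fun n f" shows "definable_fun n (\<lambda>x. - f x)"
  using definable_fun_mult[OF definable_fun_const[of n "-1"] assms] assms
  by (simp add: definable_fun_def)

lemma definable_fun_diff:
  assumes "definable_fun n f" "definable_fun n g"
  shows "definable_fun n (\<lambda>x. f x - g x)"
  using definable_fun_add[OF assms(1) definable_fun_minus[OF assms(2)]] by simp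

lemma definable_less:
  assumes "definable_fun n f" "definable_fun n g"
  shows "definable n (\<lambda>x. f x < g x)"
proof (rule definable_subst2[OF _ assms])
  have "definable 2 (\<lambda>x. 1 * x ! 1 + (-1) * x ! 0 > 0)"
    by (intro definable_gt_0 polynomial_fun_add polynomial_fun_var) auto
  then show "definable 2 (\<lambda>x. x ! 0 < x ! 1)"
    by (rule definable_cong) auto
qed

lemma definable_le:
  assumes "definable_fun n f" "definable_fun n g"
  shows "definable n (\<lambda>x. f x \<le> g x)"
  using definable_not[OF definable_less[OF assms(2,1)]] by (simp add: not_less)

lemma definable_eq:
  assumes "definable_fun n f" "definable_fun n g"
  shows "definable n (\<lambda>x. f x = g x)"
  using definable_conj[OF definable_le[OF assms] definable_le[OF assms(2,1)]]
  by (rule definable_cong) auto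

lemmas definable_intros = definable_conj definable_not definable_disj definable_imp
  definable_ex definable_all definable_less definable_le definable_eq
  definable_fun_var definable_fun_const definable_fun_add definable_fun_mult
  definable_fun_minus definable_fun_diff

definition definable_real_fun :: "(real \<Rightarrow> real) \<Rightarrow> bool" where
  "definable_real_fun h \<longleftrightarrow> definable 2 (\<lambda>x. x ! 1 = h (x ! 0))"

lemma definable_fun_real:
  assumes "definable_real_fun h" "definable_fun n f"
  shows "definable_fun n (\<lambda>x. h (f x))"
  using definable_fun_subst1[of h n f] assms by (simp add: definable_real_fun_def)

end

section \<open>Definable subsets of the line\<close>

lemma finite_frontier_real_interval:
  fixes S :: "real set"
  assumes "is_interval S"
  shows "finite (frontier S)"
proof -
  have *: "finite (frontier S)" if "U \<subseteq> S" "S \<subseteq> C" "open U" "closed C" "C - U \<subseteq> {a, b}" for U C a b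
    using closure_minimal[OF that(2,4)] interior_maximal[OF that(1,3)] that(5)
    by (intro finite_subset[of "frontier S" "{a, b}"]) (auto simp: frontier_def)
  obtain a b where ab: "S = {} \<or> S = UNIV \<or> S = {..<b} \<or> S = {..b} \<or> S = {a<..} \<or> S = {a..} \<or>
      S = {a<..<b} \<or> S = {a<..b} \<or> S = {a..<b} \<or> S = {a..b}"
    using is_real_interval[OF assms] by blast
  have left: "finite (frontier S)" if "{..<b} \<subseteq> S" "S \<subseteq> {..b}"
    using that by (rule *[of _ _ b b]) auto
  have right: "finite (frontier S)" if "{a<..} \<subseteq> S" "S \<subseteq> {a..}"
    using that by (rule *[of _ _ a a]) auto
  have both: "finite (frontier S)" if "{a<..<b} \<subseteq> S" "S \<subseteq> {a..b}"
    using that by (rule *[of _ _ a b]) auto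
  show ?thesis
    using ab
  proof (elim disjE)
    assume "S = {..<b}" then show ?thesis by (intro left) auto
  next
    assume "S = {..b}" then show ?thesis by (intro left) auto
  next
    assume "S = {a<..}" then show ?thesis by (intro right) auto
  next
    assume "S = {a..}" then show ?thesis by (intro right) auto
  next
    assume "S = {a<..<b}" then show ?thesis by (intro both) auto
  next
    assume "S = {a<..b}" then show ?thesis by (intro both) auto
  next
    assume "S = {a..<b}" then show ?thesis by (intro both) auto
  next
    assume "S = {a..b}" then show ?thesis by (intro both) auto
  qed auto
qed

lemma right_interval_avoids_finite:
  fixes t :: real
  assumes "finite F"
  obtains \<delta> where "\<delta> > 0" "{t<..<t + \<delta>} \<inter> F = {}"
proof -
  obtain \<delta> where \<delta>: "\<delta> > 0" "\<forall>y\<in>F. y \<noteq> t \<longrightarrow> \<delta> \<le> dist t y"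
    using finite_set_avoid[OF assms, of t] by blast
  then have "{t<..<t + \<delta>} \<inter> F = {}" by (force simp: dist_real_def)
  with \<delta>(1) show ?thesis by (rule that)
qed

lemma interval_avoids_frontier:
  fixes A :: "real set"
  assumes "{r<..<s} \<inter> frontier A = {}"
  shows "{r<..<s} \<subseteq> A \<or> {r<..<s} \<inter> A = {}"
  using connected_Int_frontier[of "{r<..<s}" A] assms by auto

context o_minimal_structure
begin

text \<open>
  Every finiteness statement below comes from here: by o-minimality a definable subset of the line is a
  finite union of points and intervals, and the frontier of a finite union lies in the union of
  the frontiers.
\<close>

lemma finite_frontier_definable:
  assumes "definable 1 (\<lambda>x. \<phi> (x ! 0))"
  shows "finite (frontier {t. \<phi> t})"
proof -
  from assms obtain F where F: "finite F"
    "\<And>S. S \<in> F \<Longrightarrow> is_interval S \<and> open S \<or> (\<exists>p. S = {p})"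
    "{x \<in> Rn 1. \<phi> (x ! 0)} = (\<lambda>t. [t]) ` \<Union>F"
    unfolding definable_def o_minimality by auto
  have "{t. \<phi> t} = \<Union>F"
  proof -
    have "\<phi> t \<longleftrightarrow> [t] \<in> {x \<in> Rn 1. \<phi> (x ! 0)}" for t by (simp add: Rn_def)
    then show ?thesis unfolding F(3) by auto
  qed
  moreover have "finite (frontier S)" if "S \<in> F" for S
    using F(2)[OF that] by (intro finite_frontier_real_interval) (auto simp: is_interval_1)
  then have "finite (\<Union>S\<in>F. frontier S)" using F(1) by auto
  moreover have "frontier (\<Union>F) \<subseteq> (\<Union>S\<in>F. frontier S)"
    using frontier_Union_subset[OF F(1)] by simp
  ultimately show ?thesis using finite_subset by simp
qed

text \<open>
  A definable property holds either everywhere or nowhere immediately to the right of \<open>t\<close>: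
  an interval that misses the finite frontier lies inside the set or outside it.
\<close>

lemma definable_right_germ:
  assumes "definable 1 (\<lambda>x. \<phi> (x ! 0))"
  obtains \<delta> where "\<delta> > 0" "(\<forall>y. t < y \<and> y < t + \<delta> \<longrightarrow> \<phi> y) \<or> (\<forall>y. t < y \<and> y < t + \<delta> \<longrightarrow> \<not> \<phi> y)"
proof -
  obtain \<delta> where \<delta>: "\<delta> > 0" "{t<..<t + \<delta>} \<inter> frontier {t. \<phi> t} = {}"
    using right_interval_avoids_finite[OF finite_frontier_definable[OF assms]] .
  from interval_avoids_frontier[OF \<delta>(2)] show ?thesis
    by (intro that[OF \<delta>(1)]) auto
qed

end

section \<open>Absolute continuity\<close>

lemma absolutely_continuous_on_alt:
  "absolutely_continuous_on S f \<longleftrightarrow>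
    (\<forall>\<epsilon>>0. \<exists>\<delta>>0. \<forall>D. finite D \<longrightarrow>
      (\<forall>i\<in>D. fst i \<le> snd i \<and> {fst i..snd i} \<subseteq> S) \<longrightarrow>
      disjoint_family_on (\<lambda>i. {fst i<..<snd i}) D \<longrightarrow>
      (\<Sum>i\<in>D. snd i - fst i) < \<delta> \<longrightarrow>
      (\<Sum>i\<in>D. norm (f (snd i) - f (fst i))) < \<epsilon>)"
  unfolding absolutely_continuous_on_def disjoint_family_on_def pairwise_def case_prod_beta
  by (simp only: Ball_def)

text \<open>
  Restricting intervals to a subinterval can collapse several of them to the same one-point interval, so
  images of a set of intervals are better treated as an indexed family. Degenerate
  intervals contribute nothing, and nondegenerate nonoverlapping intervals are distinct.
\<close>

lemma absolutely_continuous_on_indexed: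
  assumes "absolutely_continuous_on S f" "\<epsilon> > 0"
  obtains \<delta> where "\<delta> > 0"
    "\<And>(D :: 'i set) l r. finite D \<Longrightarrow> (\<And>i. i \<in> D \<Longrightarrow> l i \<le> r i \<and> {l i..r i} \<subseteq> S) \<Longrightarrow>
      disjoint_family_on (\<lambda>i. {l i<..<r i}) D \<Longrightarrow> (\<Sum>i\<in>D. r i - l i) < \<delta> \<Longrightarrow>
      (\<Sum>i\<in>D. norm (f (r i) - f (l i))) < \<epsilon>"
proof -
  obtain \<delta> where \<delta>: "\<delta> > 0" "\<And>D. finite D \<Longrightarrow> (\<forall>i\<in>D. fst i \<le> snd i \<and> {fst i..snd i} \<subseteq> S) \<Longrightarrow>
      disjoint_family_on (\<lambda>i. {fst i<..<snd i}) D \<Longrightarrow> (\<Sum>i\<in>D. snd i - fst i) < \<delta> \<Longrightarrow>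
      (\<Sum>i\<in>D. norm (f (snd i) - f (fst i))) < \<epsilon>"
    using assms unfolding absolutely_continuous_on_alt by meson
  show ?thesis
  proof (rule that[OF \<delta>(1)])
    fix D :: "'i set" and l r :: "'i \<Rightarrow> real"
    assume fin: "finite D" and lr: "\<And>i. i \<in> D \<Longrightarrow> l i \<le> r i \<and> {l i..r i} \<subseteq> S"
      and disj: "disjoint_family_on (\<lambda>i. {l i<..<r i}) D" and small: "(\<Sum>i\<in>D. r i - l i) < \<delta>"
    define D' where "D' = {i \<in> D. l i < r i}"
    define p where "p i = (l i, r i)" for i
    have D': "finite D'" "D' \<subseteq> D" using fin by (auto simp: D'_def)
    have inj: "inj_on p D'"
    proof (rule inj_onI, rule ccontr)
      fix i j assume ij: "i \<in> D'" "j \<in> D'" "p i = p j" "i \<noteq> j"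
      then have "{l i<..<r i} \<inter> {l i<..<r i} = {}"
        using disj D' unfolding disjoint_family_on_def p_def by (metis Pair_inject in_mono)
      then show False using ij by (simp add: D'_def)
    qed
    have "disjoint_family_on (\<lambda>i. {fst i<..<snd i}) (p ` D')"
    proof (unfold disjoint_family_on_def, intro ballI impI)
      fix x y assume "x \<in> p ` D'" "y \<in> p ` D'" "x \<noteq> y"
      then obtain i j where "i \<in> D'" "j \<in> D'" "x = p i" "y = p j" "i \<noteq> j" by blast
      then show "{fst x<..<snd x} \<inter> {fst y<..<snd y} = {}"
        using disjoint_family_onD[OF disj, of i j] D'(2) by (auto simp: p_def)
    qed
    moreover have "(\<Sum>i\<in>p ` D'. snd i - fst i) < \<delta>"
    proof -
      have "(\<Sum>i\<in>p ` D'. snd i - fst i) = (\<Sum>i\<in>D'. r i - l i)"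
        by (subst sum.reindex[OF inj]) (simp add: p_def)
      also have "\<dots> = (\<Sum>i\<in>D. r i - l i)"
        using lr by (intro sum.mono_neutral_left fin D') (force simp: D'_def)
      finally show ?thesis using small by simp
    qed
    ultimately have "(\<Sum>i\<in>p ` D'. norm (f (snd i) - f (fst i))) < \<epsilon>"
      using D' lr by (intro \<delta>(2)) (auto simp: p_def)
    also have "(\<Sum>i\<in>p ` D'. norm (f (snd i) - f (fst i))) = (\<Sum>i\<in>D'. norm (f (r i) - f (l i)))"
      by (subst sum.reindex[OF inj]) (simp add: p_def)
    also have "\<dots> = (\<Sum>i\<in>D. norm (f (r i) - f (l i)))"
    proof (intro sum.mono_neutral_left fin D' ballI)
      fix i assume "i \<in> D - D'"
      then have "l i = r i" using lr[of i] by (auto simp: D'_def)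
      then show "norm (f (r i) - f (l i)) = 0" by simp
    qed
    finally show "(\<Sum>i\<in>D. norm (f (r i) - f (l i))) < \<epsilon>" .
  qed
qed

text \<open>
  Used to glue two intervals, and to pass from real and imaginary part to a complex function.
\<close>

lemma absolutely_continuous_on_dominated:
  assumes g: "absolutely_continuous_on S g" and h: "absolutely_continuous_on S h"
    and le: "\<And>u v. u \<in> S \<Longrightarrow> v \<in> S \<Longrightarrow> u \<le> v \<Longrightarrow>
      norm (f v - f u) \<le> norm (g v - g u) + norm (h v - h u)"
  shows "absolutely_continuous_on S f"
  unfolding absolutely_continuous_on_alt
proof (intro allI impI)
  fix \<epsilon> :: real assume "\<epsilon> > 0"
  then have "\<epsilon> / 2 > 0" by simp
  obtain \<delta> where \<delta>: "\<delta> > 0" "\<And>D. finite D \<Longrightarrow> (\<forall>i\<in>D. fst i \<le> snd i \<and> {fst i..snd i} \<subseteq> S) \<Longrightarrow>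
      disjoint_family_on (\<lambda>i. {fst i<..<snd i}) D \<Longrightarrow> (\<Sum>i\<in>D. snd i - fst i) < \<delta> \<Longrightarrow>
      (\<Sum>i\<in>D. norm (g (snd i) - g (fst i))) < \<epsilon> / 2"
    using g \<open>\<epsilon> / 2 > 0\<close> unfolding absolutely_continuous_on_alt by meson
  obtain \<delta>' where \<delta>': "\<delta>' > 0" "\<And>D. finite D \<Longrightarrow> (\<forall>i\<in>D. fst i \<le> snd i \<and> {fst i..snd i} \<subseteq> S) \<Longrightarrow>
      disjoint_family_on (\<lambda>i. {fst i<..<snd i}) D \<Longrightarrow> (\<Sum>i\<in>D. snd i - fst i) < \<delta>' \<Longrightarrow>
      (\<Sum>i\<in>D. norm (h (snd i) - h (fst i))) < \<epsilon> / 2"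
    using h \<open>\<epsilon> / 2 > 0\<close> unfolding absolutely_continuous_on_alt by meson
  show "\<exists>\<delta>>0. \<forall>D. finite D \<longrightarrow> (\<forall>i\<in>D. fst i \<le> snd i \<and> {fst i..snd i} \<subseteq> S) \<longrightarrow>
      disjoint_family_on (\<lambda>i. {fst i<..<snd i}) D \<longrightarrow> (\<Sum>i\<in>D. snd i - fst i) < \<delta> \<longrightarrow>
      (\<Sum>i\<in>D. norm (f (snd i) - f (fst i))) < \<epsilon>"
  proof (intro exI[of _ "min \<delta> \<delta>'"] conjI allI impI)
    fix D :: "(real \<times> real) set"
    assume D: "finite D" "\<forall>i\<in>D. fst i \<le> snd i \<and> {fst i..snd i} \<subseteq> S"
      "disjoint_family_on (\<lambda>i. {fst i<..<snd i}) D" "(\<Sum>i\<in>D. snd i - fst i) < min \<delta> \<delta>'"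
    have "(\<Sum>i\<in>D. norm (f (snd i) - f (fst i)))
        \<le> (\<Sum>i\<in>D. norm (g (snd i) - g (fst i)) + norm (h (snd i) - h (fst i)))"
      using D(2) by (intro sum_mono le) (auto simp: subset_iff)
    also have "\<dots> < \<epsilon> / 2 + \<epsilon> / 2"
      unfolding sum.distrib using D by (intro add_strict_mono \<delta> \<delta>') auto
    finally show "(\<Sum>i\<in>D. norm (f (snd i) - f (fst i))) < \<epsilon>" by simp
  qed (use \<delta> \<delta>' in auto)
qed

definition clamp_to :: "real \<Rightarrow> real \<Rightarrow> real \<Rightarrow> real" where
  "clamp_to a b t = max a (min b t)"

lemma clamp_to_mono: "u \<le> v \<Longrightarrow> clamp_to a b u \<le> clamp_to a b v"
  by (auto simp: clamp_to_def)

lemma clamp_to_nonexpansive: "u \<le> v \<Longrightarrow> clamp_to a b v - clamp_to a b u \<le> v - u"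
  by (auto simp: clamp_to_def min_def max_def)

lemma clamp_to_in: "a \<le> b \<Longrightarrow> clamp_to a b t \<in> {a..b}"
  by (auto simp: clamp_to_def)

lemma clamp_to_interval_subset: "a \<le> b \<Longrightarrow> {clamp_to a b u<..<clamp_to a b v} \<subseteq> {u<..<v}"
  by (auto simp: clamp_to_def min_def max_def split: if_splits)

lemma disjoint_clamp_to:
  assumes "a \<le> b" "disjoint_family_on (\<lambda>i. {fst i<..<snd i}) D"
  shows "disjoint_family_on (\<lambda>i. {clamp_to a b (fst i)<..<clamp_to a b (snd i)}) D"
  using assms(2) clamp_to_interval_subset[OF assms(1)] unfolding disjoint_family_on_def by blast

text \<open>
  Clamping is monotone and does not increase distances, so it turns a short nonoverlapping
  family into a short nonoverlapping family inside \<open>[a, b]\<close>.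
\<close>

lemma absolutely_continuous_on_clamp_to:
  assumes "absolutely_continuous_on {a..b} f" "a \<le> b"
  shows "absolutely_continuous_on S (\<lambda>t. f (clamp_to a b t))"
  unfolding absolutely_continuous_on_alt
proof (intro allI impI)
  fix \<epsilon> :: real assume "\<epsilon> > 0"
  show "\<exists>\<delta>>0. \<forall>D. finite D \<longrightarrow> (\<forall>i\<in>D. fst i \<le> snd i \<and> {fst i..snd i} \<subseteq> S) \<longrightarrow>
      disjoint_family_on (\<lambda>i. {fst i<..<snd i}) D \<longrightarrow> (\<Sum>i\<in>D. snd i - fst i) < \<delta> \<longrightarrow>
      (\<Sum>i\<in>D. norm (f (clamp_to a b (snd i)) - f (clamp_to a b (fst i)))) < \<epsilon>"
  proof (rule absolutely_continuous_on_indexed[OF assms(1) \<open>\<epsilon> > 0\<close>, where ?'i = "real \<times> real"], 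
      rule exI, intro conjI allI impI)
    fix \<delta> :: real and D :: "(real \<times> real) set"
    assume \<delta>: "\<delta> > 0"
      "\<And>(D :: (real \<times> real) set) l r. finite D \<Longrightarrow> (\<And>i. i \<in> D \<Longrightarrow> l i \<le> r i \<and> {l i..r i} \<subseteq> {a..b}) \<Longrightarrow>
        disjoint_family_on (\<lambda>i. {l i<..<r i}) D \<Longrightarrow> (\<Sum>i\<in>D. r i - l i) < \<delta> \<Longrightarrow>
        (\<Sum>i\<in>D. norm (f (r i) - f (l i))) < \<epsilon>"
    show "\<delta> > 0" by fact
    assume D: "finite D" "\<forall>i\<in>D. fst i \<le> snd i \<and> {fst i..snd i} \<subseteq> S"
      "disjoint_family_on (\<lambda>i. {fst i<..<snd i}) D" "(\<Sum>i\<in>D. snd i - fst i) < \<delta>"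
    show "(\<Sum>i\<in>D. norm (f (clamp_to a b (snd i)) - f (clamp_to a b (fst i)))) < \<epsilon>"
    proof (rule \<delta>(2))
      show "finite D" by fact
    show "disjoint_family_on (\<lambda>i. {clamp_to a b (fst i)<..<clamp_to a b (snd i)}) D"
      by (rule disjoint_clamp_to) fact+
    have "(\<Sum>i\<in>D. clamp_to a b (snd i) - clamp_to a b (fst i)) \<le> (\<Sum>i\<in>D. snd i - fst i)"
      using D(2) by (intro sum_mono clamp_to_nonexpansive) auto
    then show "(\<Sum>i\<in>D. clamp_to a b (snd i) - clamp_to a b (fst i)) < \<delta>" using D(4) by simp
    fix i assume "i \<in> D"
    then have "clamp_to a b (fst i) \<le> clamp_to a b (snd i)" using D(2) clamp_to_mono by blast
    then show "clamp_to a b (fst i) \<le> clamp_to a b (snd i) \<and> {clamp_to a b (fst i)..clamp_to a b (snd i)} \<subseteq> {a..b}"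
      using clamp_to_in[OF \<open>a \<le> b\<close>, of "fst i"] clamp_to_in[OF \<open>a \<le> b\<close>, of "snd i"] by auto
    qed
  qed
qed

text \<open>
  On \<open>[a, c]\<close> the function equals \<open>f \<circ> clamp_to a b + f \<circ> clamp_to b c - f b\<close>.
\<close>

lemma absolutely_continuous_on_concat:
  assumes "absolutely_continuous_on {a..b} f" "absolutely_continuous_on {b..c} f" "a \<le> b" "b \<le> c"
  shows "absolutely_continuous_on {a..c} f"
proof (rule absolutely_continuous_on_dominated[OF absolutely_continuous_on_clamp_to[OF assms(1,3)]
      absolutely_continuous_on_clamp_to[OF assms(2,4)]])
  fix u v assume "u \<in> {a..c}" "v \<in> {a..c}"
  have *: "f t = f (clamp_to a b t) + f (clamp_to b c t) - f b" if "t \<in> {a..c}" for t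
    using that assms(3,4) by (auto simp: clamp_to_def min_def max_def)
  have "f v - f u = (f (clamp_to a b v) - f (clamp_to a b u)) + (f (clamp_to b c v) - f (clamp_to b c u))"
    using *[OF \<open>u \<in> {a..c}\<close>] *[OF \<open>v \<in> {a..c}\<close>] by algebra
  then show "norm (f v - f u) \<le> norm (f (clamp_to a b v) - f (clamp_to a b u))
      + norm (f (clamp_to b c v) - f (clamp_to b c u))"
    by (metis norm_triangle_ineq)
qed

lemma absolutely_continuous_on_trivial:
  assumes "b \<le> a" shows "absolutely_continuous_on {a..b} f"
proof -
  have "(\<Sum>i\<in>D. norm (f (snd i) - f (fst i))) = 0"
    if "\<forall>i\<in>D. fst i \<le> snd i \<and> {fst i..snd i} \<subseteq> {a..b}" for D
  proof (intro sum.neutral ballI)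
    fix i assume "i \<in> D"
    with that assms have "fst i = snd i" by force
    then show "norm (f (snd i) - f (fst i)) = 0" by simp
  qed
  then show ?thesis unfolding absolutely_continuous_on_alt by (auto intro!: exI[of _ 1])
qed

lemma absolutely_continuous_on_minus:
  "absolutely_continuous_on S f \<Longrightarrow> absolutely_continuous_on S (\<lambda>t. - f t)"
  unfolding absolutely_continuous_on_alt
  by (simp add: norm_minus_commute)

lemma absolutely_continuous_on_lipschitz:
  assumes "\<And>u v. u \<in> S \<Longrightarrow> v \<in> S \<Longrightarrow> u < v \<Longrightarrow> norm (f v - f u) \<le> K * (v - u)"
  shows "absolutely_continuous_on S f"
  unfolding absolutely_continuous_on_alt
proof (intro allI impI)
  fix \<epsilon> :: real assume "\<epsilon> > 0"
  define K' where "K' = max K 1"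
  have "K' > 0" by (simp add: K'_def)
  show "\<exists>\<delta>>0. \<forall>D. finite D \<longrightarrow> (\<forall>i\<in>D. fst i \<le> snd i \<and> {fst i..snd i} \<subseteq> S) \<longrightarrow>
      disjoint_family_on (\<lambda>i. {fst i<..<snd i}) D \<longrightarrow> (\<Sum>i\<in>D. snd i - fst i) < \<delta> \<longrightarrow>
      (\<Sum>i\<in>D. norm (f (snd i) - f (fst i))) < \<epsilon>"
  proof (intro exI[of _ "\<epsilon> / K'"] conjI allI impI)
    fix D :: "(real \<times> real) set"
    assume D: "finite D" "\<forall>i\<in>D. fst i \<le> snd i \<and> {fst i..snd i} \<subseteq> S"
      "(\<Sum>i\<in>D. snd i - fst i) < \<epsilon> / K'"
    have "norm (f (snd i) - f (fst i)) \<le> K' * (snd i - fst i)" if "i \<in> D" for i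
    proof (cases "fst i = snd i")
      case False
      with D(2) that have i: "fst i < snd i" "fst i \<in> S" "snd i \<in> S" by force+
      then have "norm (f (snd i) - f (fst i)) \<le> K * (snd i - fst i)" by (intro assms)
      also have "\<dots> \<le> K' * (snd i - fst i)" using i by (intro mult_right_mono) (auto simp: K'_def)
      finally show ?thesis .
    qed simp
    then have "(\<Sum>i\<in>D. norm (f (snd i) - f (fst i))) \<le> (\<Sum>i\<in>D. K' * (snd i - fst i))"
      by (intro sum_mono)
    also have "\<dots> = K' * (\<Sum>i\<in>D. snd i - fst i)" by (simp add: sum_distrib_left)
    also have "\<dots> < \<epsilon>" using D(3) \<open>K' > 0\<close> by (simp add: field_simps)
    finally show "(\<Sum>i\<in>D. norm (f (snd i) - f (fst i))) < \<epsilon>" .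
  qed (use \<open>K' > 0\<close> \<open>\<epsilon> > 0\<close> in auto)
qed

text \<open>
  By bisection it is enough to consider short intervals around a given \<open>x\<close>; the only
  exceptional point of such an interval can be \<open>x\<close> itself, and cutting there leaves two good pieces.
\<close>

lemma absolutely_continuous_on_finite_exceptions:
  assumes "finite F" "c \<le> d"
    and "\<And>p q. c \<le> p \<Longrightarrow> p < q \<Longrightarrow> q \<le> d \<Longrightarrow> {p<..<q} \<inter> F = {} \<Longrightarrow> absolutely_continuous_on {p..q} f"
  shows "absolutely_continuous_on {c..d} f"
proof -
  have avoid: "absolutely_continuous_on {p..q} f" if "c \<le> p" "q \<le> d" "{p<..<q} \<inter> F = {}" for p q
    using that assms(3)[of p q] absolutely_continuous_on_trivial[of q p f] by (cases "p < q") auto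
  have "c \<le> c \<and> d \<le> d \<longrightarrow> absolutely_continuous_on {c..d} f"
    using \<open>c \<le> d\<close>
  proof (induction rule: Bolzano[where P = "\<lambda>p q. c \<le> p \<and> q \<le> d \<longrightarrow> absolutely_continuous_on {p..q} f"])
    case (trans p q r)
    then show ?case
      using absolutely_continuous_on_concat[of p q f r] by auto
  next
    case (local x)
    obtain \<delta> where \<delta>: "\<delta> > 0" "\<forall>y\<in>F. y \<noteq> x \<longrightarrow> \<delta> \<le> dist x y"
      using finite_set_avoid[OF \<open>finite F\<close>, of x] by blast
    show ?case
    proof (intro exI[of _ \<delta>] conjI allI impI \<delta>(1))
      fix p q assume pq: "p \<le> x \<and> x \<le> q \<and> q - p < \<delta>" "c \<le> p \<and> q \<le> d"
      have "{p<..<x} \<inter> F = {}" "{x<..<q} \<inter> F = {}"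
        using \<delta>(2) pq(1) by (force simp: dist_real_def)+
      then show "absolutely_continuous_on {p..q} f"
        using pq by (intro absolutely_continuous_on_concat[of p x f q] avoid) auto
    qed
  qed
  then show ?thesis by simp
qed

text \<open>
  Approach the end points from the inside: the points of \<open>[r, s]\<close> are moved towards the midpoint \<open>m\<close> of
  \<open>x\<close> and \<open>y\<close> and so enter the open interval.
\<close>

lemma mono_on_closed_interval:
  fixes h :: "real \<Rightarrow> real"
  assumes "mono_on {r<..<s} h" "continuous_on {r..s} h"
  shows "mono_on {r..s} h"
proof (rule mono_onI)
  fix x y assume xy: "x \<in> {r..s}" "y \<in> {r..s}" "x \<le> y"
  show "h x \<le> h y"
  proof (cases "x = y")
    case False
    define m where "m = (x + y) / 2"
    have m: "x < m" "m < y" using xy False by (auto simp: m_def)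
    define w where "w n = inverse (real (Suc (Suc n)))" for n
    have w: "0 < w n" "w n < 1" for n by (auto simp: w_def inverse_less_1_iff)
    have wlim: "w \<longlonglongrightarrow> 0" unfolding w_def
      using LIMSEQ_Suc[OF LIMSEQ_inverse_real_of_nat] by simp
    define xs where "xs n = x + w n * (m - x)" for n
    define ys where "ys n = y - w n * (y - m)" for n
    have xs: "x < xs n" "xs n < m" for n
    proof -
      have "w n * (m - x) < 1 * (m - x)" using w m by (intro mult_strict_right_mono) auto
      then show "xs n < m" by (simp add: xs_def)
      show "x < xs n" using w m by (simp add: xs_def)
    qed
    have ys: "m < ys n" "ys n < y" for n
    proof -
      have "w n * (y - m) < 1 * (y - m)" using w m by (intro mult_strict_right_mono) auto
      then show "m < ys n" by (simp add: ys_def)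
      show "ys n < y" using w m by (simp add: ys_def)
    qed
    have in1: "xs n \<in> {r<..<s}" "ys n \<in> {r<..<s}" for n
      using xs[of n] ys[of n] xy by auto
    have "xs \<longlonglongrightarrow> x + 0 * (m - x)" "ys \<longlonglongrightarrow> y - 0 * (y - m)"
      unfolding xs_def ys_def by (intro tendsto_intros wlim)+
    then have lims: "xs \<longlonglongrightarrow> x" "ys \<longlonglongrightarrow> y" by simp_all
    have "(\<lambda>n. h (xs n)) \<longlonglongrightarrow> h x" "(\<lambda>n. h (ys n)) \<longlonglongrightarrow> h y"
      using in1 xy by (auto intro!: continuous_on_tendsto_compose[OF assms(2)] lims always_eventually
          simp: less_imp_le)
    moreover have "h (xs n) \<le> h (ys n)" for n
      using in1[of n] xs[of n] ys[of n] by (intro mono_onD[OF assms(1)]) auto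
    ultimately show ?thesis by (intro LIMSEQ_le) auto
  qed simp
qed

text \<open>
  The intervals \<open>(g (l i), g (r i))\<close> are pairwise disjoint subsets of \<open>[g p, g q]\<close>, so their
  total length is at most the length of that interval.
\<close>

lemma sum_increments_le:
  fixes g :: "real \<Rightarrow> real"
  assumes "mono_on {p..q} g" "p \<le> q" "finite D"
    and D: "\<And>i. i \<in> D \<Longrightarrow> l i \<le> r i \<and> {l i..r i} \<subseteq> {p..q}"
    and disj: "disjoint_family_on (\<lambda>i. {l i<..<r i}) D"
  shows "(\<Sum>i\<in>D. \<bar>g (r i) - g (l i)\<bar>) \<le> g q - g p"
proof -
  have mono: "g x \<le> g y" if "p \<le> x" "x \<le> y" "y \<le> q" for x y
    using assms(1) that by (auto simp: mono_on_def)
  have D': "p \<le> l i" "l i \<le> r i" "r i \<le> q" if "i \<in> D" for i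
    using D[OF that] by auto
  have *: "disjoint_family_on (\<lambda>i. {g (l i)<..<g (r i)}) D"
    unfolding disjoint_family_on_def
  proof (intro ballI impI)
    fix i j assume ij: "i \<in> D" "j \<in> D" "i \<noteq> j"
    then have "{l i<..<r i} \<inter> {l j<..<r j} = {}" using disj by (auto simp: disjoint_family_on_def)
    then have "r i \<le> l j \<or> r j \<le> l i \<or> l i = r i \<or> l j = r j"
    proof (rule contrapos_pp)
      assume "\<not> (r i \<le> l j \<or> r j \<le> l i \<or> l i = r i \<or> l j = r j)"
      then have "max (l i) (l j) < min (r i) (r j)" using D'[OF ij(1)] D'[OF ij(2)] by auto
      then obtain z where "max (l i) (l j) < z" "z < min (r i) (r j)" using dense by blast
      then have "z \<in> {l i<..<r i} \<inter> {l j<..<r j}" by simp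
      then show "{l i<..<r i} \<inter> {l j<..<r j} \<noteq> {}" by blast
    qed
    then show "{g (l i)<..<g (r i)} \<inter> {g (l j)<..<g (r j)} = {}"
      using mono[of "r i" "l j"] mono[of "r j" "l i"] D'[OF ij(1)] D'[OF ij(2)] by fastforce
  qed
  have "(\<Sum>i\<in>D. \<bar>g (r i) - g (l i)\<bar>) = (\<Sum>i\<in>D. measure lborel {g (l i)<..<g (r i)})"
    using D' mono by (intro sum.cong) auto
  also have "\<dots> = measure lborel (\<Union>i\<in>D. {g (l i)<..<g (r i)})"
    using D' mono
    by (intro measure_finite_Union[symmetric] \<open>finite D\<close> *) (auto simp: emeasure_lborel_Ioo)
  also have "\<dots> \<le> measure lborel {g p..g q}"
  proof (intro measure_mono_fmeasurable)
    show "(\<Union>i\<in>D. {g (l i)<..<g (r i)}) \<subseteq> {g p..g q}"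
    proof (intro UN_least)
      fix i assume "i \<in> D"
      then show "{g (l i)<..<g (r i)} \<subseteq> {g p..g q}"
        using D'[of i] mono[of p "l i"] mono[of "r i" q] by auto
    qed
    show "{g p..g q} \<in> fmeasurable lborel"
      by (metis box_real(2) fmeasurable_cbox)
  qed (auto intro!: sets.finite_UN \<open>finite D\<close>)
  also have "\<dots> = g q - g p" using mono[of p q] \<open>p \<le> q\<close> by simp
  finally show ?thesis .
qed

text \<open>
  Written as a first-order formula in \<open>h\<close>, without absolute values, so that the set of all such
  points is visibly definable when \<open>h\<close> is.
\<close>

definition locally_lipschitz_at :: "(real \<Rightarrow> real) \<Rightarrow> real \<Rightarrow> bool" where
  "locally_lipschitz_at h t \<longleftrightarrow> (\<exists>\<delta>. \<delta> > 0 \<and> (\<exists>K. \<forall>x. \<forall>y. t - \<delta> < x \<longrightarrow> x < y \<longrightarrow> y < t + \<delta> \<longrightarrow>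
     h y - h x \<le> K * (y - x) \<and> h x - h y \<le> K * (y - x)))"

lemma absolutely_continuous_on_locally_lipschitz:
  assumes "\<And>t. t \<in> {c..d} \<Longrightarrow> locally_lipschitz_at h t" "c \<le> d"
  shows "absolutely_continuous_on {c..d} (\<lambda>t. complex_of_real (h t))"
  using \<open>c \<le> d\<close>
proof (induction rule: Bolzano)
  case (trans p q r)
  then show ?case
    using absolutely_continuous_on_concat by blast
next
  case (local x)
  then have "locally_lipschitz_at h x" using assms(1) by auto
  then obtain \<delta> K where \<delta>: "\<delta> > 0" and K: "\<And>u v. x - \<delta> < u \<Longrightarrow> u < v \<Longrightarrow> v < x + \<delta> \<Longrightarrow>
      h v - h u \<le> K * (v - u) \<and> h u - h v \<le> K * (v - u)"
    unfolding locally_lipschitz_at_def by blast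
  show ?case
  proof (intro exI[of _ \<delta>] conjI allI impI \<delta>)
    fix p q assume pq: "p \<le> x \<and> x \<le> q \<and> q - p < \<delta>"
    show "absolutely_continuous_on {p..q} (\<lambda>t. complex_of_real (h t))"
    proof (rule absolutely_continuous_on_lipschitz[of _ _ K])
      fix u v assume "u \<in> {p..q}" "v \<in> {p..q}" "u < v"
      then have "\<bar>h v - h u\<bar> \<le> K * (v - u)" using K[of u v] pq by (auto simp: abs_le_iff)
      then show "norm (complex_of_real (h v) - complex_of_real (h u)) \<le> K * (v - u)"
        by (metis norm_of_real of_real_diff)
    qed
  qed
qed

text \<open>
  The function may fail to be Lipschitz near \<open>p\<close> and \<open>q\<close> (as a square root does), but there monotonicity
  controls all increments at once. Clamping to \<open>[p, p']\<close>, \<open>[p', q']\<close> and \<open>[q', q]\<close> splits each increment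
  into three parts, each of which sums to less than \<open>\<epsilon> / 3\<close>.
\<close>

lemma absolutely_continuous_on_mono:
  assumes cont: "continuous_on {p..q} f" and mono: "mono_on {p<..<q} f"
    and lip: "\<And>t. t \<in> {p<..<q} \<Longrightarrow> locally_lipschitz_at f t"
  shows "absolutely_continuous_on {p..q} (\<lambda>t. complex_of_real (f t))"
proof (cases "p < q")
  case True
  have mono: "mono_on {p..q} f" by (rule mono_on_closed_interval) fact+
  show ?thesis
    unfolding absolutely_continuous_on_alt
  proof (intro allI impI)
    fix \<epsilon> :: real assume "\<epsilon> > 0"
    then have \<epsilon>: "\<epsilon> / 3 > 0" by simp
    have cont': "\<exists>\<delta>>0. \<forall>y\<in>{p..q}. dist y x < \<delta> \<longrightarrow> dist (f y) (f x) < \<epsilon> / 3" if "x \<in> {p..q}" for x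
      using cont \<epsilon> that unfolding continuous_on_iff by blast
    obtain \<eta> where \<eta>: "\<eta> > 0" "\<forall>y\<in>{p..q}. dist y p < \<eta> \<longrightarrow> dist (f y) (f p) < \<epsilon> / 3"
      using cont'[of p] True by auto
    obtain \<eta>' where \<eta>': "\<eta>' > 0" "\<forall>y\<in>{p..q}. dist y q < \<eta>' \<longrightarrow> dist (f y) (f q) < \<epsilon> / 3"
      using cont'[of q] True by auto
    define w where "w = min (min \<eta> \<eta>') (q - p) / 3"
    have w: "w > 0" "w < \<eta>" "w < \<eta>'" "2 * w < q - p"
      using \<eta>(1) \<eta>'(1) True by (auto simp: w_def min_def)
    define p' where "p' = p + w"
    define q' where "q' = q - w"
    have pq': "p < p'" "p' < q'" "q' < q" using w by (auto simp: p'_def q'_def)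
    have "\<bar>f p' - f p\<bar> < \<epsilon> / 3" "\<bar>f q' - f q\<bar> < \<epsilon> / 3"
      using \<eta>(2)[rule_format, of p'] \<eta>'(2)[rule_format, of q'] w pq'
      by (auto simp: p'_def q'_def dist_real_def)
    then have fp: "f p' - f p < \<epsilon> / 3" and fq: "f q - f q' < \<epsilon> / 3" by linarith+
    have "absolutely_continuous_on {p'..q'} (\<lambda>t. complex_of_real (f t))"
      using pq' by (intro absolutely_continuous_on_locally_lipschitz lip) auto
    then have "absolutely_continuous_on {p..q} (\<lambda>t. complex_of_real (f (clamp_to p' q' t)))"
      using pq' by (intro absolutely_continuous_on_clamp_to) auto
    then obtain \<delta> where \<delta>: "\<delta> > 0" "\<And>D. finite D \<Longrightarrow> (\<forall>i\<in>D. fst i \<le> snd i \<and> {fst i..snd i} \<subseteq> {p..q}) \<Longrightarrow>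
      disjoint_family_on (\<lambda>i. {fst i<..<snd i}) D \<Longrightarrow> (\<Sum>i\<in>D. snd i - fst i) < \<delta> \<Longrightarrow>
      (\<Sum>i\<in>D. norm (complex_of_real (f (clamp_to p' q' (snd i))) - complex_of_real (f (clamp_to p' q' (fst i))))) < \<epsilon> / 3"
      using \<epsilon> unfolding absolutely_continuous_on_alt by meson
    show "\<exists>\<delta>>0. \<forall>D. finite D \<longrightarrow> (\<forall>i\<in>D. fst i \<le> snd i \<and> {fst i..snd i} \<subseteq> {p..q}) \<longrightarrow>
      disjoint_family_on (\<lambda>i. {fst i<..<snd i}) D \<longrightarrow> (\<Sum>i\<in>D. snd i - fst i) < \<delta> \<longrightarrow>
      (\<Sum>i\<in>D. norm (complex_of_real (f (snd i)) - complex_of_real (f (fst i)))) < \<epsilon>"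
    proof (intro exI[of _ \<delta>] conjI allI impI \<delta>(1))
      fix D :: "(real \<times> real) set"
      assume D: "finite D" "\<forall>i\<in>D. fst i \<le> snd i \<and> {fst i..snd i} \<subseteq> {p..q}"
        "disjoint_family_on (\<lambda>i. {fst i<..<snd i}) D" "(\<Sum>i\<in>D. snd i - fst i) < \<delta>"
      define inc where "inc a b i = \<bar>f (clamp_to a b (snd i)) - f (clamp_to a b (fst i))\<bar>" for a b i
      have split: "f t = f (clamp_to p p' t) - f p' + f (clamp_to p' q' t) - f q' + f (clamp_to q' q t)"
        if "t \<in> {p..q}" for t
        using that pq' by (auto simp: clamp_to_def min_def max_def)
      have small: "(\<Sum>i\<in>D. inc a b i) \<le> f b - f a" if "p \<le> a" "a \<le> b" "b \<le> q" for a b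
        unfolding inc_def
      proof (rule sum_increments_le[where l = "\<lambda>i. clamp_to a b (fst i)" and r = "\<lambda>i. clamp_to a b (snd i)"])
        show "mono_on {a..b} f" using mono that by (auto simp: mono_on_def)
        show "disjoint_family_on (\<lambda>i. {clamp_to a b (fst i)<..<clamp_to a b (snd i)}) D"
          using D that by (intro disjoint_clamp_to)
        show "clamp_to a b (fst i) \<le> clamp_to a b (snd i) \<and> {clamp_to a b (fst i)..clamp_to a b (snd i)} \<subseteq> {a..b}"
          if "i \<in> D" for i
          using D(2) that clamp_to_in[OF \<open>a \<le> b\<close>, of "fst i"] clamp_to_in[OF \<open>a \<le> b\<close>, of "snd i"]
          by (auto intro!: clamp_to_mono)
      qed (use that D in auto)
      have "(\<Sum>i\<in>D. norm (complex_of_real (f (snd i)) - complex_of_real (f (fst i))))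
          \<le> (\<Sum>i\<in>D. inc p p' i + inc p' q' i + inc q' q i)"
      proof (intro sum_mono)
        fix i assume "i \<in> D"
        then have "fst i \<in> {p..q}" "snd i \<in> {p..q}" using D(2) by force+
        then have "\<bar>f (snd i) - f (fst i)\<bar> \<le> inc p p' i + inc p' q' i + inc q' q i"
          using split[of "fst i"] split[of "snd i"] unfolding inc_def by linarith
        then show "norm (complex_of_real (f (snd i)) - complex_of_real (f (fst i)))
            \<le> inc p p' i + inc p' q' i + inc q' q i"
          by (metis norm_of_real of_real_diff)
      qed
      also have "\<dots> = (\<Sum>i\<in>D. inc p p' i) + (\<Sum>i\<in>D. inc p' q' i) + (\<Sum>i\<in>D. inc q' q i)"
        by (simp add: sum.distrib)
      also have "(\<Sum>i\<in>D. inc p' q' i) < \<epsilon> / 3"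
        using \<delta>(2)[OF D] by (simp add: inc_def flip: of_real_diff)
      finally show "(\<Sum>i\<in>D. norm (complex_of_real (f (snd i)) - complex_of_real (f (fst i)))) < \<epsilon>"
        using small[of p p'] small[of q' q] fp fq pq' by auto
    qed
  qed
next
  case False
  then show ?thesis by (intro absolutely_continuous_on_trivial) simp
qed

section \<open>Continuous definable functions of one variable\<close>

text \<open>
  The points of \<open>[x, y]\<close> where \<open>h\<close> is at least \<open>h x\<close> form a compact set; by the condition to the right its
  greatest element cannot be less than \<open>y\<close>.
\<close>

lemma mono_on_of_right_germs:
  fixes h :: "real \<Rightarrow> real"
  assumes cont: "continuous_on {r<..<s} h"
    and germ: "\<And>t. t \<in> {r<..<s} \<Longrightarrow> \<exists>\<delta>>0. \<forall>y. t < y \<and> y < t + \<delta> \<longrightarrow> h t \<le> h y"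
  shows "mono_on {r<..<s} h"
proof (rule mono_onI)
  fix x y assume xy: "x \<in> {r<..<s}" "y \<in> {r<..<s}" "x \<le> y"
  define Z where "Z = {z \<in> {x..y}. h x \<le> h z}"
  have "continuous_on {x..y} h"
    using xy by (intro continuous_on_subset[OF cont]) auto
  then have "closed Z"
    unfolding Z_def by (intro continuous_on_closed_Collect_le continuous_intros) auto
  moreover have "bounded Z" unfolding Z_def by (rule bounded_subset[of "{x..y}"]) auto
  ultimately have "compact Z" by (simp add: compact_eq_bounded_closed)
  moreover have "x \<in> Z" using xy by (simp add: Z_def)
  ultimately obtain z where z: "z \<in> Z" "\<And>w. w \<in> Z \<Longrightarrow> w \<le> z"
    using compact_attains_sup[of Z] by blast
  have "z = y"
  proof (rule ccontr)
    assume "z \<noteq> y"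
    then have "z < y" "z \<in> {r<..<s}" using z(1) xy by (auto simp: Z_def)
    obtain \<delta> where \<delta>: "\<delta> > 0" "\<And>w. z < w \<Longrightarrow> w < z + \<delta> \<Longrightarrow> h z \<le> h w"
      using germ[OF \<open>z \<in> {r<..<s}\<close>] by blast
    define w where "w = z + min (\<delta> / 2) (y - z)"
    have "z < w" "w < z + \<delta>" "w \<le> y" using \<delta>(1) \<open>z < y\<close> by (auto simp: w_def)
    then have "w \<in> Z" using \<delta>(2)[of w] z(1) by (auto simp: Z_def)
    then show False using z(2)[of w] \<open>z < w\<close> by simp
  qed
  then show "h x \<le> h y" using z(1) by (simp add: Z_def)
qed

text \<open>
  Finitely many points do not affect monotonicity: immediately to the right of each point there is none.
\<close>

lemma mono_on_of_mono_off_finite: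
  fixes h :: "real \<Rightarrow> real"
  assumes cont: "continuous_on {p<..<q} h" and "finite F"
    and pieces: "\<And>r s. {r<..<s} \<subseteq> {p<..<q} \<Longrightarrow> {r<..<s} \<inter> F = {} \<Longrightarrow> mono_on {r<..<s} h"
  shows "mono_on {p<..<q} h"
proof (rule mono_on_of_right_germs[OF cont])
  fix t assume t: "t \<in> {p<..<q}"
  obtain \<delta> where \<delta>: "\<delta> > 0" "{t<..<t + \<delta>} \<inter> F = {}"
    using right_interval_avoids_finite[OF \<open>finite F\<close>] .
  define u where "u = min (t + \<delta>) ((t + q) / 2)"
  have u: "t < u" "u < q" "u \<le> t + \<delta>" using \<delta>(1) t by (auto simp: u_def min_def)
  have "{t<..<u} \<subseteq> {t<..<t + \<delta>}" "{t<..<u} \<subseteq> {p<..<q}" using u t by auto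
  then have "mono_on {t<..<u} h" using \<delta>(2) by (intro pieces) auto
  moreover have "continuous_on {t..u} h"
    using u t by (intro continuous_on_subset[OF cont]) auto
  ultimately have mono: "mono_on {t..u} h" by (rule mono_on_closed_interval)
  show "\<exists>\<delta>>0. \<forall>y. t < y \<and> y < t + \<delta> \<longrightarrow> h t \<le> h y"
  proof (intro exI[of _ "u - t"] conjI allI impI)
    fix y assume "t < y \<and> y < t + (u - t)"
    then show "h t \<le> h y" by (intro mono_onD[OF mono]) auto
  qed (use u in simp)
qed

lemma locally_lipschitz_at_cong:
  assumes "locally_lipschitz_at h t" "t \<in> {p<..<q}" "\<And>x. x \<in> {p<..<q} \<Longrightarrow> f x = h x"
  shows "locally_lipschitz_at f t"
proof -
  obtain \<delta> K where \<delta>: "\<delta> > 0" and K: "\<And>u v. t - \<delta> < u \<Longrightarrow> u < v \<Longrightarrow> v < t + \<delta> \<Longrightarrow>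
      h v - h u \<le> K * (v - u) \<and> h u - h v \<le> K * (v - u)"
    using assms(1) unfolding locally_lipschitz_at_def by blast
  define \<eta> where "\<eta> = min \<delta> (min (t - p) (q - t))"
  have "f y - f x \<le> K * (y - x) \<and> f x - f y \<le> K * (y - x)"
    if xy: "t - \<eta> < x" "x < y" "y < t + \<eta>" for x y
  proof -
    have "t - \<delta> < x" "y < t + \<delta>" "x \<in> {p<..<q}" "y \<in> {p<..<q}" using xy by (auto simp: \<eta>_def)
    then show ?thesis using K[of x y] assms(3) xy(2) by auto
  qed
  moreover have "\<eta> > 0" using \<delta> assms(2) by (auto simp: \<eta>_def)
  ultimately show ?thesis unfolding locally_lipschitz_at_def by blast
qed

lemma locally_lipschitz_at_minus:
  "locally_lipschitz_at (\<lambda>t. - h t) t \<longleftrightarrow> locally_lipschitz_at h t"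
  unfolding locally_lipschitz_at_def by (simp add: conj_commute)

context o_minimal_structure
begin

text \<open>
  Let \<open>\<phi> t\<close> say that \<open>h \<ge> h t\<close> immediately to the right of \<open>t\<close>. If \<open>\<phi> t\<close> fails, then
  \<open>h < h t\<close> immediately to the right of \<open>t\<close>, by definability of the set where \<open>h \<ge> h t\<close>. Off the frontier of
  \<open>\<phi>\<close> one alternative persists on the whole interval.
\<close>

lemma definable_piecewise_monotone:
  assumes h: "definable_real_fun h"
  obtains F where "finite F"
    "\<And>r s. continuous_on {r<..<s} h \<Longrightarrow> {r<..<s} \<inter> F = {} \<Longrightarrow>
      mono_on {r<..<s} h \<or> mono_on {r<..<s} (\<lambda>t. - h t)"
proof -
  define \<phi> where "\<phi> t \<longleftrightarrow> (\<exists>\<delta>. \<delta> > 0 \<and> (\<forall>y. t < y \<longrightarrow> y < t + \<delta> \<longrightarrow> h t \<le> h y))" for t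
  have "definable 1 (\<lambda>x. \<phi> (x ! 0))" unfolding \<phi>_def
    by (intro definable_intros definable_fun_real[OF h]; simp add: definable_fun_var)
  then have "finite (frontier {t. \<phi> t})" by (rule finite_frontier_definable)
  then show ?thesis
  proof (rule that)
    fix r s assume cont: "continuous_on {r<..<s} h" and "{r<..<s} \<inter> frontier {t. \<phi> t} = {}"
    from interval_avoids_frontier[OF this(2)]
    show "mono_on {r<..<s} h \<or> mono_on {r<..<s} (\<lambda>t. - h t)"
    proof
      assume *: "{r<..<s} \<subseteq> {t. \<phi> t}"
      have "mono_on {r<..<s} h"
      proof (rule mono_on_of_right_germs[OF cont])
        fix t assume "t \<in> {r<..<s}"
        with * have "\<phi> t" by auto
        then show "\<exists>\<delta>>0. \<forall>y. t < y \<and> y < t + \<delta> \<longrightarrow> h t \<le> h y" unfolding \<phi>_def by blast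
      qed
      then show ?thesis ..
    next
      assume *: "{r<..<s} \<inter> {t. \<phi> t} = {}"
      have "mono_on {r<..<s} (\<lambda>t. - h t)"
      proof (rule mono_on_of_right_germs)
        show "continuous_on {r<..<s} (\<lambda>t. - h t)" by (intro continuous_intros cont)
        fix t assume "t \<in> {r<..<s}"
        with * have "\<not> \<phi> t" by auto
        have "definable 1 (\<lambda>x. h t \<le> h (x ! 0))"
          by (intro definable_intros definable_fun_real[OF h]; simp)
        then obtain \<delta> where "\<delta> > 0"
          "(\<forall>y. t < y \<and> y < t + \<delta> \<longrightarrow> h t \<le> h y) \<or> (\<forall>y. t < y \<and> y < t + \<delta> \<longrightarrow> \<not> h t \<le> h y)"
          by (rule definable_right_germ)
        with \<open>\<not> \<phi> t\<close> have "\<forall>y. t < y \<and> y < t + \<delta> \<longrightarrow> \<not> h t \<le> h y" unfolding \<phi>_def by blast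
        then have "\<forall>y. t < y \<and> y < t + \<delta> \<longrightarrow> - h t \<le> - h y" by force
        with \<open>\<delta> > 0\<close> show "\<exists>\<delta>>0. \<forall>y. t < y \<and> y < t + \<delta> \<longrightarrow> - h t \<le> - h y" by blast
      qed
      then show ?thesis ..
    qed
  qed
qed

lemma definable_real_fun_tilt:
  assumes "definable_real_fun h"
  shows "definable_real_fun (\<lambda>t. c * h t - K * t)"
proof -
  have "definable 2 (\<lambda>x. x ! 1 = c * h (x ! 0) - K * x ! 0)"
    by (intro definable_intros definable_fun_real[OF assms]; simp)
  then show ?thesis by (simp add: definable_real_fun_def)
qed

text \<open>
  Shrink to an interval on which \<open>c h\<close> is increasing, with \<open>c = \<plusminus>1\<close>. For \<open>K\<close> larger than one difference
  quotient of \<open>c h\<close>, the function \<open>k t = c h t - K t\<close> is not increasing, so it is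
  decreasing on one of its monotonicity intervals. There \<open>c h\<close> grows, but at rate at most \<open>K\<close>.
\<close>

lemma definable_somewhere_locally_lipschitz:
  assumes h: "definable_real_fun h" and cont: "continuous_on {p<..<q} h" and "p < q"
  shows "\<exists>t\<in>{p<..<q}. locally_lipschitz_at h t"
proof -
  obtain F where F: "finite F" "\<And>r s. continuous_on {r<..<s} h \<Longrightarrow> {r<..<s} \<inter> F = {} \<Longrightarrow>
      mono_on {r<..<s} h \<or> mono_on {r<..<s} (\<lambda>t. - h t)"
    using definable_piecewise_monotone[OF h] by metis
  obtain \<delta> where \<delta>: "\<delta> > 0" "{(p + q) / 2<..<(p + q) / 2 + \<delta>} \<inter> F = {}"
    using right_interval_avoids_finite[OF F(1)] .
  define r where "r = (p + q) / 2"
  define s where "s = min q (r + \<delta>)"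
  have rs: "p < r" "r < s" "s \<le> q" "{r<..<s} \<inter> F = {}"
    using \<open>p < q\<close> \<delta> by (auto simp: r_def s_def)
  have cont': "continuous_on {r<..<s} h"
    using rs by (intro continuous_on_subset[OF cont]) auto
  obtain c where c: "c = 1 \<or> c = -1" and mono: "mono_on {r<..<s} (\<lambda>t. c * h t)"
  proof (cases "mono_on {r<..<s} h")
    case True
    then show ?thesis using that[of 1] by simp
  next
    case False
    then show ?thesis using F(2)[OF cont' rs(4)] that[of "-1"] by simp
  qed
  obtain x y where xy: "r < x" "x < y" "y < s"
    using dense[OF rs(2)] dense by metis
  define K where "K = (c * h y - c * h x) / (y - x) + 1"
  define k where "k t = c * h t - K * t" for t
  have "K * (y - x) = c * h y - c * h x + (y - x)" using xy by (simp add: K_def distrib_right)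
  then have "k y - k x = - (y - x)" by (simp add: k_def algebra_simps)
  then have "k y < k x" using xy by simp
  then have not_mono: "\<not> mono_on {r<..<s} k"
    using mono_onD[of "{r<..<s}" k x y] xy by auto
  have kcont: "continuous_on {r<..<s} k" unfolding k_def by (intro continuous_intros cont')
  have "definable_real_fun k" unfolding k_def by (rule definable_real_fun_tilt[OF h])
  then obtain G where G: "finite G" "\<And>a b. continuous_on {a<..<b} k \<Longrightarrow> {a<..<b} \<inter> G = {} \<Longrightarrow>
      mono_on {a<..<b} k \<or> mono_on {a<..<b} (\<lambda>t. - k t)"
    using definable_piecewise_monotone by metis
  obtain a b where ab: "{a<..<b} \<subseteq> {r<..<s}" "{a<..<b} \<inter> G = {}" "\<not> mono_on {a<..<b} k"
    using mono_on_of_mono_off_finite[OF kcont G(1)] not_mono by blast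
  have "a < b" using ab(3) by (cases "a < b") (auto simp: mono_on_def)
  have kmono: "mono_on {a<..<b} (\<lambda>t. - k t)"
    using G(2)[of a b] ab continuous_on_subset[OF kcont ab(1)] by blast
  have lip: "h v - h u \<le> K * (v - u) \<and> h u - h v \<le> K * (v - u)" if "a < u" "u < v" "v < b" for u v
  proof -
    have "u \<in> {r<..<s}" "v \<in> {r<..<s}" using that ab(1) by (auto simp: subset_iff)
    then have "c * h u \<le> c * h v" using that mono by (auto simp: mono_on_def)
    moreover have "- k u \<le> - k v" using that kmono by (auto simp: mono_on_def)
    ultimately show ?thesis using c by (auto simp: k_def algebra_simps)
  qed
  define t where "t = (a + b) / 2"
  have t: "a < t" "t < b" using \<open>a < b\<close> by (auto simp: t_def)
  have "locally_lipschitz_at h t"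
    unfolding locally_lipschitz_at_def
    by (rule exI[of _ "min (t - a) (b - t)"]) (use t lip in \<open>auto intro!: exI[of _ K]\<close>)
  moreover have "t \<in> {p<..<q}"
    using t ab(1) rs by (auto simp: subset_iff)
  ultimately show ?thesis by blast
qed

text \<open>
  An interval that misses the frontier of the locally Lipschitz points and contains one of them
  consists of them.
\<close>

lemma definable_piecewise_locally_lipschitz:
  assumes h: "definable_real_fun h"
  obtains F where "finite F"
    "\<And>r s t. continuous_on {r<..<s} h \<Longrightarrow> {r<..<s} \<inter> F = {} \<Longrightarrow> t \<in> {r<..<s} \<Longrightarrow> locally_lipschitz_at h t"
proof -
  have "definable 1 (\<lambda>x. locally_lipschitz_at h (x ! 0))"
    unfolding locally_lipschitz_at_def
    by (intro definable_intros definable_fun_real[OF h]; simp add: definable_fun_var)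
  then have "finite (frontier {t. locally_lipschitz_at h t})" by (rule finite_frontier_definable)
  then show ?thesis
  proof (rule that)
    fix r s t
    assume cont: "continuous_on {r<..<s} h" and "t \<in> {r<..<s}"
      and "{r<..<s} \<inter> frontier {t. locally_lipschitz_at h t} = {}"
    from interval_avoids_frontier[OF this(3)]
      definable_somewhere_locally_lipschitz[OF h cont] \<open>t \<in> {r<..<s}\<close>
    show "locally_lipschitz_at h t" by auto
  qed
qed

text \<open>
  Definability is asked for a function \<open>h\<close> on the whole line and continuity for a function \<open>f\<close>
  that agrees with \<open>h\<close> on the open interval: this leaves the values at the end points
  to \<open>f\<close> and makes \<open>h\<close> total.
\<close>

lemma absolutely_continuous_on_definable:
  assumes h: "definable_real_fun h" and cont: "continuous_on {p..q} f" and "p < q"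
    and eq: "\<And>t. t \<in> {p<..<q} \<Longrightarrow> f t = h t"
  shows "absolutely_continuous_on {p..q} (\<lambda>t. complex_of_real (f t))"
proof -
  have hcont: "continuous_on {r<..<s} h" if "p \<le> r" "s \<le> q" for r s
  proof -
    have "continuous_on {r<..<s} f" using that by (intro continuous_on_subset[OF cont]) auto
    then show ?thesis by (rule continuous_on_eq) (use that eq in auto)
  qed
  obtain F where F: "finite F" "\<And>r s. continuous_on {r<..<s} h \<Longrightarrow> {r<..<s} \<inter> F = {} \<Longrightarrow>
      mono_on {r<..<s} h \<or> mono_on {r<..<s} (\<lambda>t. - h t)"
    using definable_piecewise_monotone[OF h] by metis
  obtain G where G: "finite G" "\<And>r s t. continuous_on {r<..<s} h \<Longrightarrow> {r<..<s} \<inter> G = {} \<Longrightarrow>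
      t \<in> {r<..<s} \<Longrightarrow> locally_lipschitz_at h t"
    using definable_piecewise_locally_lipschitz[OF h] by metis
  show ?thesis
  proof (rule absolutely_continuous_on_finite_exceptions[of "F \<union> G"])
    fix r s assume rs: "p \<le> r" "r < s" "s \<le> q" "{r<..<s} \<inter> (F \<union> G) = {}"
    have lip: "locally_lipschitz_at f t" if "t \<in> {r<..<s}" for t
    proof (rule locally_lipschitz_at_cong[OF _ that])
      show "locally_lipschitz_at h t" using G(2)[OF hcont _ that] rs by blast
      show "f x = h x" if "x \<in> {r<..<s}" for x using that rs eq by auto
    qed
    have fcont: "continuous_on {r..s} f" using rs by (intro continuous_on_subset[OF cont]) auto
    have "mono_on {r<..<s} h \<or> mono_on {r<..<s} (\<lambda>t. - h t)"
      using F(2)[OF hcont] rs by blast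
    then have "mono_on {r<..<s} f \<or> mono_on {r<..<s} (\<lambda>t. - f t)"
      using eq rs by (auto simp: mono_on_def)
    then show "absolutely_continuous_on {r..s} (\<lambda>t. complex_of_real (f t))"
    proof
      assume "mono_on {r<..<s} f"
      then show ?thesis by (intro absolutely_continuous_on_mono fcont lip)
    next
      assume "mono_on {r<..<s} (\<lambda>t. - f t)"
      then have "absolutely_continuous_on {r..s} (\<lambda>t. complex_of_real (- f t))"
        by (intro absolutely_continuous_on_mono continuous_intros fcont)
          (auto simp: locally_lipschitz_at_minus lip)
      then show ?thesis using absolutely_continuous_on_minus by fastforce
    qed
  qed (use F G \<open>p < q\<close> in auto)
qed

end

section \<open>Continuous branches of a finite definable multifunction\<close>

text \<open>
  There are at least \<open>m\<close> points below \<open>x\<close> in the fibre of \<open>S\<close> over \<open>t\<close>. The recursion avoids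
  cardinalities, so that for each fixed \<open>m\<close> it unfolds to a first-order formula.
\<close>

primrec at_least_below :: "(real \<Rightarrow> real \<Rightarrow> bool) \<Rightarrow> nat \<Rightarrow> real \<Rightarrow> real \<Rightarrow> bool" where
  "at_least_below S 0 t x \<longleftrightarrow> True"
| "at_least_below S (Suc m) t x \<longleftrightarrow> (\<exists>y. y < x \<and> S t y \<and> at_least_below S m t y)"

lemma at_least_below_iff_card:
  assumes fin: "finite {y. S t y}"
  shows "at_least_below S m t x \<longleftrightarrow> m \<le> card {y. S t y \<and> y < x}"
proof (induction m arbitrary: x)
  case 0
  then show ?case by simp
next
  case (Suc m)
  have fin': "finite {y. S t y \<and> y < z}" for z
    using fin by (rule rev_finite_subset) auto
  show ?case
  proof
    assume "at_least_below S (Suc m) t x"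
    then obtain y where y: "y < x" "S t y" "m \<le> card {z. S t z \<and> z < y}"
      using Suc.IH by auto
    have "Suc m \<le> card (insert y {z. S t z \<and> z < y})" using y(3) fin' by simp
    also have "\<dots> \<le> card {z. S t z \<and> z < x}" using y by (intro card_mono fin') auto
    finally show "Suc m \<le> card {z. S t z \<and> z < x}" .
  next
    let ?B = "{z. S t z \<and> z < x}"
    assume card: "Suc m \<le> card ?B"
    define y where "y = Max ?B"
    have "?B \<noteq> {}" using card by (metis card.empty not_less_eq_eq zero_le)
    then have y: "y \<in> ?B" unfolding y_def using fin' by (intro Max_in)
    have "?B - {y} \<subseteq> {z. S t z \<and> z < y}"
      using Max_ge[OF fin', of _ x] by (force simp: y_def[symmetric])
    then have "card (?B - {y}) \<le> card {z. S t z \<and> z < y}" by (intro card_mono fin')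
    then have "m \<le> card {z. S t z \<and> z < y}" using card y fin' by simp
    then show "at_least_below S (Suc m) t x" using y Suc.IH by auto
  qed
qed

lemma tendsto_eventually_less:
  fixes f g :: "'a \<Rightarrow> real"
  assumes "(f \<longlongrightarrow> a) F" "(g \<longlongrightarrow> b) F" "a < b"
  shows "eventually (\<lambda>t. f t < g t) F"
proof -
  have "((\<lambda>t. g t - f t) \<longlongrightarrow> b - a) F" by (intro tendsto_intros assms)
  then have "eventually (\<lambda>t. 0 < g t - f t) F" using assms(3) by (intro order_tendstoD) auto
  then show ?thesis by eventually_elim simp
qed

text \<open>
  Choose one index for each value below \<open>x j\<close>. In the limit process the chosen functions
  stay distinct and stay below \<open>f j\<close>; further values may appear when coinciding values separate,
  but none is lost.
\<close>

lemma eventually_rank_ge: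
  fixes f :: "'i \<Rightarrow> 'a \<Rightarrow> real"
  assumes "finite J" "j \<in> J" and lim: "\<And>i. i \<in> J \<Longrightarrow> (f i \<longlongrightarrow> x i) F"
  shows "eventually (\<lambda>t. card {y \<in> x ` J. y < x j} \<le> card {y \<in> (\<lambda>i. f i t) ` J. y < f j t}) F"
proof -
  have "{y \<in> x ` J. y < x j} \<subseteq> x ` J" by auto
  then obtain B where B: "B \<subseteq> J" "inj_on x B" "{y \<in> x ` J. y < x j} = x ` B"
    using subset_image_inj[of "{y \<in> x ` J. y < x j}" x J] by metis
  have "finite B" using B(1) \<open>finite J\<close> by (rule finite_subset)
  have "eventually (\<lambda>t. \<forall>b\<in>B. f b t < f j t) F"
  proof (intro eventually_ball_finite \<open>finite B\<close> ballI)
    fix b assume "b \<in> B"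
    then have "x b < x j" using B(3) by auto
    moreover have "b \<in> J" using \<open>b \<in> B\<close> B(1) by blast
    ultimately show "eventually (\<lambda>t. f b t < f j t) F"
      using tendsto_eventually_less[OF lim lim] \<open>j \<in> J\<close> by blast
  qed
  moreover have "eventually (\<lambda>t. \<forall>b\<in>B. \<forall>b'\<in>B. b \<noteq> b' \<longrightarrow> f b t \<noteq> f b' t) F"
  proof (intro eventually_ball_finite \<open>finite B\<close> ballI)
    fix b b' assume b: "b \<in> B" "b' \<in> B"
    show "eventually (\<lambda>t. b \<noteq> b' \<longrightarrow> f b t \<noteq> f b' t) F"
    proof (cases "b = b'")
      case False
      then have "x b < x b' \<or> x b' < x b" using inj_onD[OF B(2) _ b] by (meson linorder_neqE)
      then have "eventually (\<lambda>t. f b t < f b' t) F \<or> eventually (\<lambda>t. f b' t < f b t) F"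
        using tendsto_eventually_less[OF lim[of b] lim[of b']]
          tendsto_eventually_less[OF lim[of b'] lim[of b]] b B(1) by blast
      then show ?thesis by (elim disjE) (auto elim: eventually_mono)
    qed simp
  qed
  ultimately show ?thesis
  proof eventually_elim
    case (elim t)
    have "card B \<le> card {y \<in> (\<lambda>i. f i t) ` J. y < f j t}"
    proof (rule card_inj_on_le)
      show "inj_on (\<lambda>b. f b t) B" using elim(2) by (auto simp: inj_on_def)
    qed (use elim(1) B(1) \<open>finite J\<close> in auto)
    then show ?case using B(2,3) by (simp add: card_image)
  qed
qed

text \<open>
  The numbers \<open>r\<close> of values below and \<open>c\<close> of values above are lower semicontinuous with
  \<open>r + c + 1 = k\<close>, so neither can jump. The bound for \<open>c\<close> is that for \<open>r\<close> applied to the functions \<open>- f i\<close>.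
\<close>

lemma rank_constant:
  fixes f :: "'i \<Rightarrow> real \<Rightarrow> real"
  assumes "finite J" "j \<in> J" and cont: "\<And>i. i \<in> J \<Longrightarrow> continuous_on U (f i)"
    and "connected U" and card: "\<And>t. t \<in> U \<Longrightarrow> card ((\<lambda>i. f i t) ` J) = k"
    and "s \<in> U" "t \<in> U"
  shows "card {y \<in> (\<lambda>i. f i s) ` J. y < f j s} = card {y \<in> (\<lambda>i. f i t) ` J. y < f j t}"
proof -
  define r where "r t = card {y \<in> (\<lambda>i. f i t) ` J. y < f j t}" for t
  define c where "c t = card {y \<in> (\<lambda>i. - f i t) ` J. y < - f j t}" for t
  have sum: "r t + c t + 1 = k" if "t \<in> U" for t
  proof -
    have "{y \<in> (\<lambda>i. - f i t) ` J. y < - f j t} = uminus ` {y \<in> (\<lambda>i. f i t) ` J. f j t < y}"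
      by (auto simp: image_iff)
    then have c: "c t = card {y \<in> (\<lambda>i. f i t) ` J. f j t < y}"
      unfolding c_def by (simp add: card_image)
    have "(\<lambda>i. f i t) ` J = {y \<in> (\<lambda>i. f i t) ` J. y < f j t} \<union> {y \<in> (\<lambda>i. f i t) ` J. f j t < y} \<union> {f j t}"
      using \<open>j \<in> J\<close> by auto
    also have "card \<dots> = r t + c t + 1"
      unfolding c r_def using \<open>finite J\<close> by (subst card_Un_disjoint; (subst card_Un_disjoint)?) auto
    finally show ?thesis using card[OF that] by simp
  qed
  have "r s = r t"
  proof (rule connected_local_const[OF \<open>connected U\<close> \<open>s \<in> U\<close> \<open>t \<in> U\<close>], intro ballI)
    fix t assume t: "t \<in> U"
    have lim: "(f i \<longlongrightarrow> f i t) (at t within U)" if "i \<in> J" for i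
      using cont[OF that] t by (simp add: continuous_on_def)
    have "eventually (\<lambda>u. r t \<le> r u) (at t within U)"
      unfolding r_def by (rule eventually_rank_ge) (use assms lim in auto)
    moreover have "eventually (\<lambda>u. c t \<le> c u) (at t within U)"
      unfolding c_def by (rule eventually_rank_ge) (use assms lim in \<open>auto intro!: tendsto_minus\<close>)
    moreover have "eventually (\<lambda>u. u \<in> U) (at t within U)"
      by (simp add: eventually_at_topological) blast
    ultimately show "eventually (\<lambda>u. r t = r u) (at t within U)"
    proof eventually_elim
      case (elim u)
      then show ?case using sum[OF t] sum[of u] by linarith
    qed
  qed
  then show ?thesis by (simp add: r_def)
qed

context o_minimal_structure
begin

lemma definable_at_least_below:
  assumes S: "definable 2 (\<lambda>x. S (x ! 0) (x ! 1))"
  shows "definable 2 (\<lambda>x. at_least_below S m (x ! 0) (x ! 1))"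
proof (induction m)
  case 0
  then show ?case by (simp add: definable_True)
next
  case (Suc m)
  show ?case unfolding at_least_below.simps
    by (intro definable_intros definable_subst2[OF S] definable_subst2[OF Suc]; simp add: definable_fun_var)
qed

text \<open>
  Only the union \<open>S\<close> of the graphs is given as definable, but it determines each branch piece by piece:
  between two consecutive points of the finite exceptional set, the branch \<open>f j\<close> has constant rank
  \<open>l\<close> in the fibre and is thereby definable from \<open>S\<close>.
\<close>

lemma absolutely_continuous_on_branch:
  fixes f :: "'i \<Rightarrow> real \<Rightarrow> real"
  assumes S: "definable 2 (\<lambda>x. S (x ! 0) (x ! 1))" and J: "finite J" "j \<in> J"
    and cont: "\<And>i. i \<in> J \<Longrightarrow> continuous_on {c..d} (f i)"
    and fibre: "\<And>t x. t \<in> {c..d} \<Longrightarrow> S t x \<longleftrightarrow> (\<exists>i\<in>J. x = f i t)"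
  shows "absolutely_continuous_on {c..d} (\<lambda>t. complex_of_real (f j t))"
proof (cases "c \<le> d")
  case True
  have fib: "{x. S t x} = (\<lambda>i. f i t) ` J" if "t \<in> {c..d}" for t
    using fibre[OF that] by auto
  have fin: "finite {x. S t x}" if "t \<in> {c..d}" for t
    using fib[OF that] J(1) by simp
  \<comment> \<open>the set of all \<open>t\<close> whose fibre has at least \<open>m\<close> points\<close>
  define N where "N m = {t. \<exists>x. at_least_below S m t x}" for m
  have N: "t \<in> N m \<longleftrightarrow> m \<le> card {x. S t x}" if t: "t \<in> {c..d}" for t m
  proof
    assume "t \<in> N m"
    then obtain x where "m \<le> card {y. S t y \<and> y < x}"
      by (auto simp: N_def at_least_below_iff_card[of S, OF fin[OF t]])
    also have "\<dots> \<le> card {y. S t y}" by (intro card_mono fin[OF t]) auto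
    finally show "m \<le> card {x. S t x}" .
  next
    assume m: "m \<le> card {x. S t x}"
    obtain b where b: "\<And>y. S t y \<Longrightarrow> y \<le> b"
      using bdd_above_finite[OF fin[OF t]] by (auto simp: bdd_above_def)
    have "y < b + 1" if "S t y" for y using b[OF that] by simp
    then have "{y. S t y \<and> y < b + 1} = {y. S t y}" by auto
    then have "at_least_below S m t (b + 1)"
      unfolding at_least_below_iff_card[of S, OF fin[OF t]] using m by simp
    then show "t \<in> N m" by (auto simp: N_def)
  qed
  have "finite (frontier (N m))" for m
    unfolding N_def
    by (rule finite_frontier_definable,
        intro definable_intros definable_subst2[OF definable_at_least_below[OF S]]; simp add: definable_fun_var)
  then have F: "finite (\<Union>m\<le>card J. frontier (N m))" by simp
  show ?thesis
  proof (rule absolutely_continuous_on_finite_exceptions[OF F True])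
    fix p q assume pq: "c \<le> p" "p < q" "q \<le> d" "{p<..<q} \<inter> (\<Union>m\<le>card J. frontier (N m)) = {}"
    have sub: "{p<..<q} \<subseteq> {c..d}" using pq by auto
    have card_le: "card {x. S t x} \<le> card {x. S s x}" if "s \<in> {p<..<q}" "t \<in> {p<..<q}" for s t
    proof -
      have "card {x. S t x} \<le> card J"
        using subsetD[OF sub that(2)] J(1) by (simp add: fib card_image_le)
      then have "{p<..<q} \<inter> frontier (N (card {x. S t x})) = {}" using pq(4) by auto
      from interval_avoids_frontier[OF this] show ?thesis
        using N[of t] N[of s] sub that by blast
    qed
    have m: "(p + q) / 2 \<in> {p<..<q}" using pq(2) by auto
    have card: "card ((\<lambda>i. f i t) ` J) = card {x. S ((p + q) / 2) x}" if "t \<in> {p<..<q}" for t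
      using card_le[OF that m] card_le[OF m that] fib[OF subsetD[OF sub that]] by simp
    define l where "l = card {y \<in> (\<lambda>i. f i ((p + q) / 2)) ` J. y < f j ((p + q) / 2)}"
    have rank: "card {y. S t y \<and> y < f j t} = l" if "t \<in> {p<..<q}" for t
    proof -
      have "card {y \<in> (\<lambda>i. f i t) ` J. y < f j t} = l"
        unfolding l_def
        by (rule rank_constant[OF J _ _ card that m])
          (auto intro: continuous_on_subset[OF cont sub])
      moreover have "{y. S t y \<and> y < f j t} = {y \<in> (\<lambda>i. f i t) ` J. y < f j t}"
        using fibre[OF subsetD[OF sub that]] by auto
      ultimately show ?thesis by simp
    qed
    define h where "h t = (if p < t \<and> t < q then f j t else 0)" for t
    have graph: "x = f j t \<longleftrightarrow> S t x \<and> at_least_below S l t x \<and> \<not> at_least_below S (Suc l) t x"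
      if t: "t \<in> {p<..<q}" for t x
    proof -
      have fin_t: "finite {y. S t y}" using fin[OF subsetD[OF sub t]] .
      have S_j: "S t (f j t)" using fibre[OF subsetD[OF sub t]] J(2) by auto
      have less: "card {y. S t y \<and> y < u} < card {y. S t y \<and> y < v}" if "S t u" "u < v" for u v
        using that by (intro psubset_card_mono finite_subset[OF _ fin_t]) auto
      have "x = f j t \<longleftrightarrow> S t x \<and> card {y. S t y \<and> y < x} = l"
        using less[of x "f j t"] less[of "f j t" x] S_j rank[OF t] by (cases x "f j t" rule: linorder_cases) auto
      then show ?thesis
        unfolding at_least_below_iff_card[of S, OF fin_t] by auto
    qed
    have "definable 2 (\<lambda>x. (p < x ! 0 \<and> x ! 0 < q \<and> S (x ! 0) (x ! 1) \<and> at_least_below S l (x ! 0) (x ! 1)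
        \<and> \<not> at_least_below S (Suc l) (x ! 0) (x ! 1)) \<or> (\<not> (p < x ! 0 \<and> x ! 0 < q) \<and> x ! 1 = 0))"
      by (intro definable_conj definable_disj definable_not S definable_at_least_below definable_less
          definable_eq definable_fun_var definable_fun_const) auto
    then have "definable 2 (\<lambda>x. x ! 1 = h (x ! 0))"
      by (rule definable_cong) (auto simp: h_def graph simp del: at_least_below.simps)
    then have "definable_real_fun h" by (simp add: definable_real_fun_def)
    moreover have "continuous_on {p..q} (f j)"
      using pq by (intro continuous_on_subset[OF cont[OF J(2)]]) auto
    ultimately show "absolutely_continuous_on {p..q} (\<lambda>t. complex_of_real (f j t))"
      using pq(2) by (rule absolutely_continuous_on_definable) (simp add: h_def)
  qed
next
  case False
  then show ?thesis by (intro absolutely_continuous_on_trivial) simp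
qed

end

section \<open>Roots of a definable curve of polynomials\<close>

context o_minimal_structure
begin

lemma definable_open_interval:
  assumes "is_interval I" "open I"
  shows "definable 1 (\<lambda>x. x ! 0 \<in> I)"
proof -
  have "(\<lambda>t. [t]) ` \<Union>{I} \<in> M 1"
    unfolding o_minimality using assms by (intro exI[of _ "{I}"]) auto
  moreover have "(\<lambda>t. [t]) ` \<Union>{I} = {x \<in> Rn 1. x ! 0 \<in> I}"
    by (auto simp: Rn_def length_Suc_conv)
  ultimately show ?thesis by (simp add: definable_def)
qed

text \<open>
  Extending by \<open>0\<close> outside \<open>I\<close> turns the coefficients into total functions, which can be
  substituted freely into formulas.
\<close>

lemma definable_complex_funD:
  assumes f: "definable_complex_fun M I f" and I: "is_interval I" "open I"
  shows "definable_real_fun (\<lambda>t. Re (if t \<in> I then f t else 0))" (is ?re)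
    and "definable_real_fun (\<lambda>t. Im (if t \<in> I then f t else 0))" (is ?im)
proof -
  define \<Gamma> where "\<Gamma> t u v \<longleftrightarrow> t \<in> I \<and> u = Re (f t) \<and> v = Im (f t)" for t u v
  have "(\<lambda>x. x @ [Re (f (hd x)), Im (f (hd x))]) ` ((\<lambda>t. [t]) ` I) \<in> M 3"
    using f by (simp add: definable_complex_fun_def definable_map_def numeral_3_eq_3)
  also have "(\<lambda>x. x @ [Re (f (hd x)), Im (f (hd x))]) ` ((\<lambda>t. [t]) ` I)
      = {x \<in> Rn 3. \<Gamma> (x ! 0) (x ! 1) (x ! 2)}"
    by (auto simp: Rn_def \<Gamma>_def length_Suc_conv numeral_3_eq_3 numeral_2_eq_2 image_image)
  finally have \<Gamma>: "definable 3 (\<lambda>x. \<Gamma> (x ! 0) (x ! 1) (x ! 2))"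
    by (simp add: definable_def)
  have outside: "definable 2 (\<lambda>x. x ! 0 \<notin> I \<and> x ! 1 = 0)"
    by (intro definable_conj definable_not definable_subst1[OF definable_open_interval[OF I]]
        definable_eq definable_fun_var definable_fun_const) auto
  have "definable 2 (\<lambda>x. (\<exists>z. \<Gamma> (x ! 0) (x ! 1) z) \<or> (x ! 0 \<notin> I \<and> x ! 1 = 0))"
    by (intro definable_disj outside definable_ex definable_subst3[OF \<Gamma>]; simp add: definable_fun_var)
  then have "definable 2 (\<lambda>x. x ! 1 = Re (if x ! 0 \<in> I then f (x ! 0) else 0))"
    by (rule definable_cong) (auto simp: \<Gamma>_def)
  then show ?re by (simp add: definable_real_fun_def)
  have "definable 2 (\<lambda>x. (\<exists>z. \<Gamma> (x ! 0) z (x ! 1)) \<or> (x ! 0 \<notin> I \<and> x ! 1 = 0))"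
    by (intro definable_disj outside definable_ex definable_subst3[OF \<Gamma>]; simp add: definable_fun_var)
  then have "definable 2 (\<lambda>x. x ! 1 = Im (if x ! 0 \<in> I then f (x ! 0) else 0))"
    by (rule definable_cong) (auto simp: \<Gamma>_def)
  then show ?im by (simp add: definable_real_fun_def)
qed

definition definable_cfun :: "nat \<Rightarrow> (real list \<Rightarrow> complex) \<Rightarrow> bool" where
  "definable_cfun n f \<longleftrightarrow> definable_fun n (\<lambda>x. Re (f x)) \<and> definable_fun n (\<lambda>x. Im (f x))"

lemma definable_cfun_const: "0 < n \<Longrightarrow> definable_cfun n (\<lambda>x. c)"
  by (simp add: definable_cfun_def definable_fun_const)

lemma definable_cfun_add:
  "definable_cfun n f \<Longrightarrow> definable_cfun n g \<Longrightarrow> definable_cfun n (\<lambda>x. f x + g x)"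
  by (simp add: definable_cfun_def definable_fun_add)

lemma definable_cfun_mult:
  "definable_cfun n f \<Longrightarrow> definable_cfun n g \<Longrightarrow> definable_cfun n (\<lambda>x. f x * g x)"
  by (simp add: definable_cfun_def definable_fun_add definable_fun_diff definable_fun_mult)

lemma definable_cfun_power:
  assumes "0 < n" "definable_cfun n f" shows "definable_cfun n (\<lambda>x. f x ^ k)"
  by (induction k) (auto intro: definable_cfun_const definable_cfun_mult assms)

lemma definable_cfun_sum:
  assumes "0 < n" "\<And>i. i \<in> A \<Longrightarrow> definable_cfun n (f i)"
  shows "definable_cfun n (\<lambda>x. \<Sum>i\<in>A. f i x)"
  using assms(2)
  by (induction A rule: infinite_finite_induct) (auto intro: definable_cfun_const definable_cfun_add assms(1))

lemma definable_cfun_eq_0: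
  assumes "definable_cfun n f" shows "definable n (\<lambda>x. f x = 0)"
proof -
  have "0 < n" using assms by (simp add: definable_cfun_def definable_fun_def)
  then have "definable n (\<lambda>x. Re (f x) = 0 \<and> Im (f x) = 0)"
    using assms unfolding definable_cfun_def by (intro definable_conj definable_eq definable_fun_const) auto
  then show ?thesis by (rule definable_cong) (simp add: complex_eq_iff)
qed

text \<open>
  The variables are \<open>t\<close> and the real and imaginary part of the root.
\<close>

lemma definable_roots:
  assumes a: "\<And>j. j \<in> {1..n} \<Longrightarrow> definable_complex_fun M I (a j)" and I: "is_interval I" "open I"
  defines "A \<equiv> \<lambda>j t. if t \<in> I then a j t else 0"
  shows "definable 3 (\<lambda>x. Complex (x ! 1) (x ! 2) ^ n
    + (\<Sum>j=1..n. (-1) ^ j * A j (x ! 0) * Complex (x ! 1) (x ! 2) ^ (n - j)) = 0)"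
proof -
  have z: "definable_cfun 3 (\<lambda>x. Complex (x ! 1) (x ! 2))"
    by (simp add: definable_cfun_def definable_fun_var)
  have A: "definable_cfun 3 (\<lambda>x. A j (x ! 0))" if "j \<in> {1..n}" for j
    unfolding definable_cfun_def A_def
    by (intro conjI definable_fun_real[OF definable_complex_funD(1)[OF a[OF that] I]]
        definable_fun_real[OF definable_complex_funD(2)[OF a[OF that] I]] definable_fun_var) auto
  show ?thesis
    by (intro definable_cfun_eq_0 definable_cfun_add definable_cfun_sum definable_cfun_mult
        definable_cfun_power definable_cfun_const z A) auto
qed

end

theorem theorem7p5:
  fixes M :: "nat \<Rightarrow> real list set set"
    and I :: "real set"
    and n :: nat
    and a :: "nat \<Rightarrow> real \<Rightarrow> complex"
    and P :: "real \<Rightarrow> complex poly"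
    and lam :: "nat \<Rightarrow> real \<Rightarrow> complex"
  assumes "o_minimal_structure M"
    and "is_interval I" and "open I"
    and "\<And>t. t \<in> I \<Longrightarrow> P t = monom 1 n + (\<Sum>j=1..n. monom ((-1) ^ j * a j t) (n - j))"
    and "\<And>j. j \<in> {1..n} \<Longrightarrow> definable_complex_fun M I (a j)"
    and "\<And>j. j \<in> {1..n} \<Longrightarrow> continuous_on I (a j)"
    and "\<And>j. j \<in> {1..n} \<Longrightarrow> continuous_on I (lam j)"
    and "\<And>t. t \<in> I \<Longrightarrow> P t = (\<Prod>j=1..n. [:- lam j t, 1:])"
  shows "\<forall>j\<in>{1..n}. \<forall>c d. {c..d} \<subseteq> I \<longrightarrow> absolutely_continuous_on {c..d} (lam j)"
proof (intro ballI allI impI)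
  interpret o_minimal_structure M by fact
  fix j c d assume j: "j \<in> {1..n}" and cd: "{c..d} \<subseteq> I"
  define Z where "Z t u v \<longleftrightarrow> Complex u v ^ n
    + (\<Sum>j=1..n. (-1) ^ j * (if t \<in> I then a j t else 0) * Complex u v ^ (n - j)) = 0" for t u v
  have Z: "definable 3 (\<lambda>x. Z (x ! 0) (x ! 1) (x ! 2))"
    unfolding Z_def by (rule definable_roots) (use assms in auto)
  have roots: "Z t u v \<longleftrightarrow> (\<exists>i\<in>{1..n}. Complex u v = lam i t)" if "t \<in> I" for t u v
  proof -
    have "Z t u v \<longleftrightarrow> poly (P t) (Complex u v) = 0"
      using that by (simp add: Z_def assms(4) poly_sum poly_monom)
    also have "\<dots> \<longleftrightarrow> (\<exists>i\<in>{1..n}. Complex u v = lam i t)"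
      using that by (simp add: assms(8) poly_prod)
    finally show ?thesis .
  qed
  have cont: "continuous_on {c..d} (lam i)" if "i \<in> {1..n}" for i
    using assms(7)[OF that] cd by (rule continuous_on_subset)
  have "absolutely_continuous_on {c..d} (\<lambda>t. complex_of_real (Re (lam j t)))"
  proof (rule absolutely_continuous_on_branch[where f = "\<lambda>i t. Re (lam i t)"])
    show "definable 2 (\<lambda>x. \<exists>v. Z (x ! 0) (x ! 1) v)"
      by (intro definable_ex definable_subst3[OF Z]; simp add: definable_fun_var)
    show "(\<exists>v. Z t x v) \<longleftrightarrow> (\<exists>i\<in>{1..n}. x = Re (lam i t))" if "t \<in> {c..d}" for t x
      using that cd by (auto simp: roots complex_eq_iff subset_iff)
  qed (use j cont in \<open>auto intro!: continuous_intros\<close>)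
  moreover have "absolutely_continuous_on {c..d} (\<lambda>t. complex_of_real (Im (lam j t)))"
  proof (rule absolutely_continuous_on_branch[where f = "\<lambda>i t. Im (lam i t)"])
    show "definable 2 (\<lambda>x. \<exists>u. Z (x ! 0) u (x ! 1))"
      by (intro definable_ex definable_subst3[OF Z]; simp add: definable_fun_var)
    show "(\<exists>u. Z t u x) \<longleftrightarrow> (\<exists>i\<in>{1..n}. x = Im (lam i t))" if "t \<in> {c..d}" for t x
      using that cd by (auto simp: roots complex_eq_iff subset_iff)
  qed (use j cont in \<open>auto intro!: continuous_intros\<close>)
  ultimately show "absolutely_continuous_on {c..d} (lam j)"
  proof (rule absolutely_continuous_on_dominated)
    fix u v
    have "norm (lam j v - lam j u) \<le> \<bar>Re (lam j v - lam j u)\<bar> + \<bar>Im (lam j v - lam j u)\<bar>"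
      by (rule cmod_le)
    then show "norm (lam j v - lam j u) \<le> norm (complex_of_real (Re (lam j v)) - complex_of_real (Re (lam j u)))
        + norm (complex_of_real (Im (lam j v)) - complex_of_real (Im (lam j u)))"
      by (simp flip: of_real_diff)
  qed
qed

end
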